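(* Let $\mathbb{F}$ be a field of characteristic not $2$, and let $\mathbf{A}$ be a $6$-dimensional nilpotent anticommutative $\mathfrak{CD}$-algebra over $\mathbb{F}$. Then $\mathbf{A}$ is isomorphic to a Malcev algebra or to $\mathbf{B}_{6,1}^{\alpha}$ for some $\alpha\in\mathbb{F}$, where $\mathbf{B}_{6,1}^{\alpha}$ is the anticommutative algebra with basis $e_1,\dots,e_6$ and products $$[e_{1},e_{2}]=e_{4},\quad [e_{1},e_{3}]=e_{5},\quad [e_{2},e_{3}]=\alpha e_{6},\quad [e_{4},e_{5}]=e_{6}.$$ Moreover, every $6$-dimensional nilpotent Malcev algebra over $\mathbb{F}$ is a $\mathfrak{CD}$-algebra.
   Context: An algebra is a vector space with a bilinear product $[-,-]$, not assumed associative; it is anticommutative if $[x,x]=0$ for all $x$. The multiplication of an anticommutative algebra is specified by giving only the nonzero products among basis elements, with $[e_j,e_i]=-[e_i,e_j]$ understood. With $\mathcal{J}(x,y,z):=[[x,y],z]+[[y,z],x]+[[z,x],y]$, an anticommutative algebra $A$ is a Malcev algebra if $\mathcal{J}(x,y,[x,z])=[\mathcal{J}(x,y,z),x]$ for all $x,y,z\in A$. Set $A^{1}=A$, $A^{n+1}=[A^{n},A^{1}]+[A^{n-1},A^{2}]+\cdots+[A^{1},A^{n}]$; $A$ is nilpotent if $A^{n}=0$ for some $n$. An algebra $A$ is a $\mathfrak{CD}$-algebra if every commutator of two multiplication operators is a derivation: $T_xT_y-T_yT_x\in\mathfrak{Der}(A)$ for all $x,y\in A$ and all $T_z\in\{R_z,L_z\}$,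 where $R_z,L_z$ are right and left multiplication by $z$ and $\mathfrak{Der}(A)$ is the Lie algebra of derivations of $A$. For an anticommutative algebra this is equivalent to the single identity $$[[[x,y],a],b]-[[[x,y],b],a]=[[[x,a],b],y]-[[[x,b],a],y]+[x,[[y,a],b]]-[x,[[y,b],a]].$$ *)

theory Defs
  imports "HOL-Analysis.Analysis"
begin

locale nonassoc_algebra = vector_space scale
  for scale :: "'f::field \<Rightarrow> 'a::ab_group_add \<Rightarrow> 'a" +
  fixes mul :: "'a \<Rightarrow> 'a \<Rightarrow> 'a" (infixl "\<star>" 70)
  assumes linear_left_mul: "Vector_Spaces.linear scale scale (\<lambda>y. x \<star> y)"
    and linear_right_mul: "Vector_Spaces.linear scale scale (\<lambda>x. x \<star> y)"
begin

definition product_subspace :: "'a set \<Rightarrow> 'a set \<Rightarrow> 'a set"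
  where "product_subspace U V = span {u \<star> v | u v. u \<in> U \<and> v \<in> V}"

text \<open>
  The powers are indexed from 1; the value at 0 is a dummy. A finite sum of subspaces is the
  span of their union.
\<close>

function alg_power :: "nat \<Rightarrow> 'a set"
  where "alg_power n = (if n \<le> 1 then UNIV
    else span (\<Union>i\<in>{1..<n}. product_subspace (alg_power i) (alg_power (n - i))))"
  by auto
termination by (relation "Wellfounded.measure (\<lambda>n. n)") auto

declare alg_power.simps [simp del]

definition nilpotent :: bool
  where "nilpotent \<longleftrightarrow> (\<exists>n\<ge>1. alg_power n = {0})"

definition derivations :: "('a \<Rightarrow> 'a) set"
  where "derivations = {D. Vector_Spaces.linear scale scale D \<and>
    (\<forall>x y. D (x \<star> y) = D x \<star> y + x \<star> D y)}"

definition mult_operators :: "'a \<Rightarrow> ('a \<Rightarrow> 'a) set"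
  where "mult_operators z = {\<lambda>w. w \<star> z, \<lambda>w. z \<star> w}"

definition jacobian :: "'a \<Rightarrow> 'a \<Rightarrow> 'a \<Rightarrow> 'a"
  where "jacobian x y z = (x \<star> y) \<star> z + (y \<star> z) \<star> x + (z \<star> x) \<star> y"

end

locale anticommutative_algebra = nonassoc_algebra +
  assumes mul_self: "x \<star> x = 0"

locale malcev_algebra = anticommutative_algebra +
  assumes malcev: "jacobian x y (x \<star> z) = jacobian x y z \<star> x"

text \<open>The two operators may be of different kinds (one left, one right).\<close>

locale cd_algebra = nonassoc_algebra +
  assumes commutator_derivation:
    "S \<in> mult_operators x \<Longrightarrow> T \<in> mult_operators y \<Longrightarrow>
      (\<lambda>w. S (T w) - T (S w)) \<in> derivations"

definition algebra_isomorphic ::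
    "('f::field \<Rightarrow> 'a::ab_group_add \<Rightarrow> 'a) \<Rightarrow> ('a \<Rightarrow> 'a \<Rightarrow> 'a) \<Rightarrow>
     ('f \<Rightarrow> 'b::ab_group_add \<Rightarrow> 'b) \<Rightarrow> ('b \<Rightarrow> 'b \<Rightarrow> 'b) \<Rightarrow> bool"
  where "algebra_isomorphic s1 m1 s2 m2 \<longleftrightarrow>
    (\<exists>f. Vector_Spaces.linear s1 s2 f \<and> bij f \<and> (\<forall>x y. f (m1 x y) = m2 (f x) (f y)))"

text \<open>The algebra is realised on \<open>'f ^ 6\<close>, with the standard basis vector \<open>axis i 1\<close> as \<open>e\<^sub>i\<close>.\<close>

definition B61 :: "'f::field \<Rightarrow> 'f ^ 6 \<Rightarrow> 'f ^ 6 \<Rightarrow> 'f ^ 6"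
  where "B61 \<alpha> x y =
      (x $ 1 * y $ 2 - x $ 2 * y $ 1) *s axis 4 1
    + (x $ 1 * y $ 3 - x $ 3 * y $ 1) *s axis 5 1
    + (\<alpha> * (x $ 2 * y $ 3 - x $ 3 * y $ 2) + (x $ 4 * y $ 5 - x $ 5 * y $ 4)) *s axis 6 1"

lemma B61_basis_products:
  fixes \<alpha> :: "'f::field"
  defines "e \<equiv> \<lambda>i::6. axis i (1::'f)"
  shows "B61 \<alpha> (e 1) (e 2) = e 4" "B61 \<alpha> (e 1) (e 3) = e 5"
    "B61 \<alpha> (e 2) (e 3) = \<alpha> *s e 6" "B61 \<alpha> (e 4) (e 5) = e 6"
    "B61 \<alpha> (e 1) (e 4) = 0" "B61 \<alpha> (e 1) (e 5) = 0" "B61 \<alpha> (e 1) (e 6) = 0"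
    "B61 \<alpha> (e 2) (e 4) = 0" "B61 \<alpha> (e 2) (e 5) = 0" "B61 \<alpha> (e 2) (e 6) = 0"
    "B61 \<alpha> (e 3) (e 4) = 0" "B61 \<alpha> (e 3) (e 5) = 0" "B61 \<alpha> (e 3) (e 6) = 0"
    "B61 \<alpha> (e 4) (e 6) = 0" "B61 \<alpha> (e 5) (e 6) = 0"
  by (simp_all add: e_def B61_def axis_def)

lemma anticommutative_algebra_B61: "anticommutative_algebra (*s) (B61 \<alpha>)"
  by unfold_locales (simp_all add: B61_def vec_eq_iff algebra_simps)

end

theory Submission
  imports Defs
begin

text \<open>
  The lower central series \<open>C\<^sub>1 = A\<close>, \<open>C\<^sub>n\<^sub>+\<^sub>1 = [C\<^sub>n, A]\<close> is strictly decreasing, so dimension 6 leaves few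
  possibilities for \<open>d = dim (A / C\<^sub>2)\<close>. Both identities live in degree 4: they are trivial if \<open>C\<^sub>4 = 0\<close>
  and \<open>[C\<^sub>2, C\<^sub>2] = 0\<close>, which is the case for \<open>d \<ge> 4\<close>. If \<open>d = 2\<close> then \<open>C\<^sub>6 = 0\<close>, and either identity
  makes the algebra a Lie algebra, hence both hold. If \<open>d = 3\<close> and \<open>C\<^sub>4 \<noteq> 0\<close>, the dimensions of the
  factors are \<open>3, 1, 1, 1\<close>, and in a suitable basis each identity amounts to the same conditions on the
  structure constants. In the remaining case \<open>d = 3\<close>, \<open>C\<^sub>4 = 0\<close>, \<open>[C\<^sub>2, C\<^sub>2] \<noteq> 0\<close>, a change of basis produces
  \<open>B\<^bsub>6,1\<^esub>\<^sup>\<alpha>\<close>, and the Malcev identity fails because it forces \<open>[[x, y], [x, z]] = 0\<close>.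
\<close>

section \<open>Bilinear calculus and the two classes of algebras as identities\<close>

context anticommutative_algebra
begin

lemma add_mul: "(u + v) \<star> w = u \<star> w + v \<star> w"
  and scale_mul: "scale k u \<star> w = scale k (u \<star> w)"
  using linear_right_mul[of w] by (simp_all add: Vector_Spaces.linear_iff)

lemma mul_add: "w \<star> (u + v) = w \<star> u + w \<star> v"
  and mul_scale: "w \<star> scale k u = scale k (w \<star> u)"
  using linear_left_mul[of w] by (simp_all add: Vector_Spaces.linear_iff)

lemma zero_mul [simp]: "0 \<star> w = 0" and mul_zero [simp]: "w \<star> 0 = 0"
  using scale_mul[of 0 0 w] mul_scale[of w 0 0] by simp_all

lemma minus_mul: "(- u) \<star> w = - (u \<star> w)" and mul_minus: "w \<star> (- u) = - (w \<star> u)"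
  using scale_mul[of "-1" u w] mul_scale[of w "-1" u] by simp_all

lemma diff_mul: "(u - v) \<star> w = u \<star> w - v \<star> w"
  using add_mul[of u "- v" w] by (simp add: minus_mul)

lemma mul_diff: "w \<star> (u - v) = w \<star> u - w \<star> v"
  using mul_add[of w u "- v"] by (simp add: mul_minus)

lemmas bilinear_simps = add_mul mul_add scale_mul mul_scale minus_mul mul_minus diff_mul mul_diff

lemma mul_anticommute: "v \<star> u = - (u \<star> v)"
proof -
  have "(u + v) \<star> (u + v) = u \<star> u + v \<star> u + (u \<star> v + v \<star> v)"
    by (simp only: add_mul mul_add)
  then have "0 = v \<star> u + u \<star> v"
    by (simp add: mul_self)
  then show ?thesis
    by (metis eq_neg_iff_add_eq_0)
qed

text \<open>In terms of right multiplications this is R_b R_a - R_a R_b.\<close>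

definition commutator_op :: "'b \<Rightarrow> 'b \<Rightarrow> 'b \<Rightarrow> 'b"
  where "commutator_op a b w = (w \<star> a) \<star> b - (w \<star> b) \<star> a"

definition cd_identity :: bool
  where "cd_identity \<longleftrightarrow> (\<forall>a b u v. commutator_op a b (u \<star> v) =
    commutator_op a b u \<star> v + u \<star> commutator_op a b v)"

definition malcev_identity :: bool
  where "malcev_identity \<longleftrightarrow> (\<forall>x y z. jacobian x y (x \<star> z) = jacobian x y z \<star> x)"

text \<open>Anticommutativity gives L_z = -R_z, so every commutator of multiplication operators is,
  up to sign, a commutator of right multiplications, and a sign does not affect being a
  derivation.\<close>

lemma cd_algebra_iff: "cd_algebra scale (\<star>) \<longleftrightarrow> cd_identity"
proof
  assume "cd_algebra scale (\<star>)"
  then interpret cd: cd_algebra scale "(\<star>)" .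
  have "commutator_op a b \<in> derivations" for a b
    using cd.commutator_derivation[of "\<lambda>w. w \<star> b" b "\<lambda>w. w \<star> a" a]
    by (simp add: mult_operators_def commutator_op_def[abs_def])
  then show cd_identity
    by (auto simp: derivations_def cd_identity_def)
next
  assume cd: cd_identity
  show "cd_algebra scale (\<star>)"
  proof
    fix S T x y
    assume S: "S \<in> mult_operators x" and T: "T \<in> mult_operators y"
    have lin: "Vector_Spaces.linear scale scale (\<lambda>w. S (T w) - T (S w))"
      using S T vector_space_axioms
      by (auto simp: mult_operators_def Vector_Spaces.linear_iff bilinear_simps algebra_simps scale_right_diff_distrib)
    have op: "R \<in> mult_operators z \<Longrightarrow> R = (\<lambda>w. w \<star> z) \<or> R = (\<lambda>w. - (w \<star> z))" for R z
      unfolding mult_operators_def by (auto intro!: ext mul_anticommute)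
    have "(\<forall>w. S (T w) - T (S w) = commutator_op y x w) \<or> (\<forall>w. S (T w) - T (S w) = - commutator_op y x w)"
      using op[OF S] op[OF T] by (auto simp: commutator_op_def minus_mul)
    then show "(\<lambda>w. S (T w) - T (S w)) \<in> derivations"
    proof
      assume "\<forall>w. S (T w) - T (S w) = commutator_op y x w"
      then show ?thesis
        using cd lin by (auto simp: cd_identity_def derivations_def)
    next
      assume "\<forall>w. S (T w) - T (S w) = - commutator_op y x w"
      then show ?thesis
        using cd lin by (auto simp: cd_identity_def derivations_def bilinear_simps)
    qed
  qed
qed

lemma malcev_algebra_iff: "malcev_algebra scale (\<star>) \<longleftrightarrow> malcev_identity"
  by (auto simp: malcev_identity_def malcev_algebra_def malcev_algebra_axioms_def
      anticommutative_algebra_axioms)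

section \<open>Products of subspaces and the lower central series\<close>

lemma subspace_product: "subspace (product_subspace U V)"
  by (simp add: product_subspace_def)

lemma product_subspace_mem: "u \<in> U \<Longrightarrow> v \<in> V \<Longrightarrow> u \<star> v \<in> product_subspace U V"
  unfolding product_subspace_def by (rule span_base) blast

lemma product_subspace_minimal:
  assumes "subspace W" "\<And>u v. u \<in> U \<Longrightarrow> v \<in> V \<Longrightarrow> u \<star> v \<in> W"
  shows "product_subspace U V \<subseteq> W"
  unfolding product_subspace_def using assms by (intro span_minimal) auto

text \<open>The index is shifted: \<open>lcs n\<close> is \<open>C\<^sub>n\<^sub>+\<^sub>1\<close>.\<close>

primrec lcs :: "nat \<Rightarrow> 'b set"
  where "lcs 0 = UNIV"
  | "lcs (Suc n) = product_subspace (lcs n) UNIV"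

lemma subspace_lcs [simp]: "subspace (lcs n)"
  by (cases n) (simp_all add: subspace_product)

lemma zero_mem_lcs [simp]: "0 \<in> lcs n"
  by (simp add: subspace_0)

lemma lcs_mul: "u \<in> lcs n \<Longrightarrow> u \<star> v \<in> lcs (Suc n)"
  by (simp add: product_subspace_mem)

lemma mul_lcs: "u \<in> lcs n \<Longrightarrow> v \<star> u \<in> lcs (Suc n)"
  using lcs_mul[of u n v] mul_anticommute[of v u] subspace_neg[OF subspace_lcs]
  by (metis (no_types))

lemma lcs_Suc_subset: "lcs (Suc n) \<subseteq> lcs n"
proof (induction n)
  case (Suc n)
  then show ?case
    unfolding lcs.simps(2)[of "Suc n"]
    by (intro product_subspace_minimal) (auto intro: lcs_mul simp del: lcs.simps)
qed simp

lemma lcs_antimono: "m \<le> n \<Longrightarrow> lcs n \<subseteq> lcs m"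
  by (rule lift_Suc_antimono_le[of lcs, OF lcs_Suc_subset])

text \<open>Of the sum that defines A^(n+1), the series C_(n+1) uses only the summand [A^n, A^1].
  This carries nilpotency over to the lower central series.\<close>

lemma lcs_subset_alg_power: "lcs n \<subseteq> alg_power (Suc n)"
proof (induction n)
  case 0
  then show ?case by (simp add: alg_power.simps)
next
  case (Suc n)
  have *: "alg_power (Suc (Suc n)) =
      span (\<Union>i\<in>{1..<Suc (Suc n)}. product_subspace (alg_power i) (alg_power (Suc (Suc n) - i)))"
    by (subst alg_power.simps) simp
  have U: "alg_power 1 = UNIV"
    by (simp add: alg_power.simps)
  have "u \<star> v \<in> alg_power (Suc (Suc n))" if "u \<in> lcs n" for u v
  proof -
    have "u \<star> v \<in> product_subspace (alg_power (Suc n)) (alg_power (Suc (Suc n) - Suc n))"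
      using that Suc.IH U by (intro product_subspace_mem) auto
    \<comment> \<open>The summand \<open>i = Suc n\<close>, whose second factor is
      \<open>alg_power 1\<close>, the whole algebra.\<close>
    moreover have "Suc n \<in> {1..<Suc (Suc n)}"
      by simp
    ultimately show ?thesis
      unfolding * by (intro span_base UN_I)
  qed
  then show ?case
    unfolding lcs.simps using * by (intro product_subspace_minimal) auto
qed

lemma lcs_eventually_zero:
  assumes nilpotent
  obtains n where "lcs n = {0}"
proof -
  from assms obtain n where "n \<ge> 1" "alg_power n = {0}"
    unfolding nilpotent_def by blast
  then show ?thesis
    using that[of "n - 1"] lcs_subset_alg_power[of "n - 1"] zero_mem_lcs[of "n - 1"] by fastforce
qed

text \<open>Once two consecutive terms agree the series is constant from there on, while nilpotency
  makes some term zero.\<close>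

lemma lcs_strict:
  assumes nilpotent "lcs (Suc n) = lcs n"
  shows "lcs n = {0}"
proof -
  have "lcs (n + k) = lcs n" for k
    using assms(2) by (induction k) simp_all
  moreover obtain m where "lcs m = {0}"
    using lcs_eventually_zero[OF assms(1)] .
  ultimately show ?thesis
    using lcs_antimono[of m "n + m"] zero_mem_lcs[of n] by (metis add.commute le_add2 singletonD subset_singletonD empty_iff)
qed

lemma subspace_mul_into: "subspace W \<Longrightarrow> subspace {u. \<forall>v. u \<star> v \<in> W}"
  by (auto intro!: subspaceI subspace_add subspace_scale simp: bilinear_simps subspace_0)

text \<open>Here \<open>T\<close> represents \<open>lcs n\<close> modulo \<open>lcs (Suc n)\<close>.
  The error terms multiply into \<open>lcs (Suc (Suc n))\<close>, so only the products of elements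
  of \<open>T\<close> have to be checked.\<close>

lemma lcs_Suc_minimal:
  assumes "subspace W" "lcs n \<subseteq> span (T \<union> lcs (Suc n))" "lcs (Suc (Suc n)) \<subseteq> W"
    "\<And>t v. t \<in> T \<Longrightarrow> t \<star> v \<in> W"
  shows "lcs (Suc n) \<subseteq> W"
proof -
  have "T \<union> lcs (Suc n) \<subseteq> {u. \<forall>v. u \<star> v \<in> W}"
    using assms(3,4) lcs_mul[of _ "Suc n"] by blast
  then have "span (T \<union> lcs (Suc n)) \<subseteq> {u. \<forall>v. u \<star> v \<in> W}"
    by (rule span_minimal[OF _ subspace_mul_into[OF assms(1)]])
  then have "product_subspace (lcs n) UNIV \<subseteq> W"
    using assms(1,2) by (intro product_subspace_minimal) blast+
  then show ?thesis
    by simp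
qed

lemma subspace_left_mul: "subspace W \<Longrightarrow> subspace {v. u \<star> v \<in> W}"
  by (auto intro!: subspaceI subspace_add subspace_scale simp: bilinear_simps subspace_0)

text \<open>Both factors may be reduced modulo C_2 because [C_2, A] lies in C_3; what remains are
  brackets of two generators.\<close>

lemma lcs_1_minimal:
  assumes "span (S \<union> lcs 1) = UNIV" "subspace W" "lcs 2 \<subseteq> W"
    "\<And>s t. s \<in> S \<Longrightarrow> t \<in> S \<Longrightarrow> s \<star> t \<in> W"
  shows "lcs 1 \<subseteq> W"
proof -
  have lcs: "u \<star> v \<in> W" "v \<star> u \<in> W" if "u \<in> lcs 1" for u v
    using lcs_mul[OF that] mul_lcs[OF that] assms(3) by (auto simp: numeral_2_eq_2 simp del: lcs.simps)
  have "s \<star> v \<in> W" if "s \<in> S" for s v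
    using span_minimal[OF _ subspace_left_mul[OF assms(2)], of "S \<union> lcs 1" s] assms(1,4) lcs(2) that
    by blast
  then have "u \<star> v \<in> W" for u v
    using span_minimal[OF _ subspace_mul_into[OF assms(2)], of "S \<union> lcs 1"] assms(1) lcs(1) by blast
  then show ?thesis
    using product_subspace_minimal[OF assms(2), of UNIV UNIV] by simp
qed

lemma subspace_right_mul: "subspace W \<Longrightarrow> subspace {v. v \<star> u \<in> W}"
  by (auto intro!: subspaceI subspace_add subspace_scale simp: bilinear_simps subspace_0)

lemma mul_span_mem:
  assumes "subspace W" "v \<in> span T"
  shows "(\<And>t. t \<in> T \<Longrightarrow> u \<star> t \<in> W) \<Longrightarrow> u \<star> v \<in> W"
    and "(\<And>t. t \<in> T \<Longrightarrow> t \<star> u \<in> W) \<Longrightarrow> v \<star> u \<in> W"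
  using span_subspace_induct[OF assms(2) subspace_left_mul[OF assms(1)], of u]
    span_subspace_induct[OF assms(2) subspace_right_mul[OF assms(1)], of u] by simp_all

lemma mul_span_zero:
  assumes "v \<in> span T"
  shows "(\<And>t. t \<in> T \<Longrightarrow> u \<star> t = 0) \<Longrightarrow> u \<star> v = 0"
    and "(\<And>t. t \<in> T \<Longrightarrow> t \<star> u = 0) \<Longrightarrow> v \<star> u = 0"
  using mul_span_mem[OF subspace_single_0 assms, of u] by simp_all

section \<open>The Jacobian, and conditions under which both identities hold\<close>

lemma jacobian_cyclic: "jacobian u v w = jacobian v w u"
  by (simp add: jacobian_def ac_simps)

lemma jacobian_swap: "jacobian v u w = - jacobian u v w"
  using mul_anticommute[of u v] mul_anticommute[of w v] mul_anticommute[of w u]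
  by (simp add: jacobian_def minus_mul)

lemma jacobian_add: "jacobian (u + u') v w = jacobian u v w + jacobian u' v w"
  by (simp add: jacobian_def bilinear_simps)

lemma jacobian_scale: "jacobian (scale k u) v w = scale k (jacobian u v w)"
  by (simp add: jacobian_def bilinear_simps scale_right_distrib)

lemma subspace_jacobian_kernel: "subspace {u. jacobian u v w = 0}"
  by (auto intro!: subspaceI simp: jacobian_add jacobian_scale) (simp add: jacobian_def)

text \<open>The Malcev identity is quadratic in its first argument. This is its polarisation: the
  instance at \<open>a + a'\<close> minus those at \<open>a\<close> and \<open>a'\<close>.\<close>

lemma malcev_polar:
  assumes malcev_identity
  shows "jacobian a b (a' \<star> d) + jacobian a' b (a \<star> d) = jacobian a b d \<star> a' + jacobian a' b d \<star> a"
proof -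
  note m = assms[unfolded malcev_identity_def, rule_format]
  have "jacobian (a + a') b ((a + a') \<star> d) = (jacobian a b (a \<star> d) + jacobian a' b (a' \<star> d)) +
      (jacobian a b (a' \<star> d) + jacobian a' b (a \<star> d))"
    by (simp add: jacobian_add add_mul) (simp add: jacobian_def bilinear_simps algebra_simps)
  moreover have "jacobian (a + a') b d \<star> (a + a') = (jacobian a b d \<star> a + jacobian a' b d \<star> a') +
      (jacobian a b d \<star> a' + jacobian a' b d \<star> a)"
    by (simp add: jacobian_add bilinear_simps)
  ultimately show ?thesis
    using m[of "a + a'" b d] m[of a b d] m[of a' b d] by simp
qed

lemma lie_imp_malcev_identity: "(\<And>u v w. jacobian u v w = 0) \<Longrightarrow> malcev_identity"
  by (simp add: malcev_identity_def)

text \<open>The Jacobi identity turns the commutator of two right multiplications into right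
  multiplication by \<open>a \<star> b\<close>, which is a derivation by the Jacobi identity
  again.\<close>

lemma lie_imp_cd_identity:
  assumes "\<And>u v w. jacobian u v w = 0"
  shows cd_identity
proof -
  have ad: "commutator_op a b w = w \<star> (a \<star> b)" for a b w
    using assms[of w a b] mul_anticommute[of "a \<star> b" w] mul_anticommute[of b w] 
    by (simp add: commutator_op_def jacobian_def minus_mul algebra_simps)
  show ?thesis
    unfolding cd_identity_def ad
  proof (intro allI)
    fix a b u v
    show "(u \<star> v) \<star> (a \<star> b) = (u \<star> (a \<star> b)) \<star> v + u \<star> (v \<star> (a \<star> b))"
      using assms[of u v "a \<star> b"] mul_anticommute[of u "v \<star> (a \<star> b)"] mul_anticommute[of "a \<star> b" u]
      by (simp add: jacobian_def minus_mul algebra_simps)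
  qed
qed

text \<open>Each term of either identity is a product of four elements, so up to sign and order of
  factors it has the shape [[[u,v],w],t], in C_4, or [[u,v],[w,t]], in [C_2, C_2].\<close>

lemma degree_four_zero:
  assumes "lcs 3 = {0}" "\<And>u v. u \<in> lcs 1 \<Longrightarrow> v \<in> lcs 1 \<Longrightarrow> u \<star> v = 0"
  shows cd_identity malcev_identity
proof -
  have 1: "u \<star> v \<in> lcs 1" for u v
    using lcs_mul[of u 0 v] by simp
  then have 2: "(u \<star> v) \<star> w \<in> lcs 2" for u v w
    using lcs_mul[of "u \<star> v" 1 w] by (simp add: numeral_2_eq_2)
  then have "((u \<star> v) \<star> w) \<star> t \<in> lcs 3" for u v w t
    using lcs_mul[OF 2] by (simp add: eval_nat_numeral)
  then have 3: "((u \<star> v) \<star> w) \<star> t = 0" for u v w t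
    using assms(1) by blast
  then have 4: "t \<star> ((u \<star> v) \<star> w) = 0" for u v w t
    using mul_anticommute[of t "(u \<star> v) \<star> w"] by simp
  have 5: "(w \<star> (u \<star> v)) \<star> t = 0" for u v w t
    using 3 mul_anticommute[of w "u \<star> v"] by (simp add: minus_mul)
  have 6: "(u \<star> v) \<star> (w \<star> t) = 0" for u v w t
    using assms(2) 1 by blast
  show cd_identity
    by (simp add: cd_identity_def commutator_op_def 3 4 diff_mul mul_diff)
  show malcev_identity
    by (simp add: malcev_identity_def jacobian_def 3 4 5 6 bilinear_simps)
qed

declare lcs.simps(2) [simp del]

lemma lcs_mem:
  "u \<star> v \<in> lcs 1" "u \<in> lcs 1 \<Longrightarrow> u \<star> v \<in> lcs 2" "u \<in> lcs 1 \<Longrightarrow> v \<star> u \<in> lcs 2"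
  "u \<in> lcs 2 \<Longrightarrow> u \<star> v \<in> lcs 3" "u \<in> lcs 2 \<Longrightarrow> v \<star> u \<in> lcs 3"
  using lcs_mul[of u 0 v] lcs_mul[of u 1 v] lcs_mul[of u 2 v] mul_lcs[of u 1 v] mul_lcs[of u 2 v]
  by (simp_all add: eval_nat_numeral)

end

section \<open>Two-generated algebras\<close>

locale two_generated_algebra = anticommutative_algebra +
  fixes x y
  assumes generators: "span ({x, y} \<union> lcs 1) = UNIV"
    and lcs_5: "lcs 5 = {0}"
    and scale_2_eq_zero: "scale 2 v = 0 \<Longrightarrow> v = 0"
begin

text \<open>\<open>c\<close> spans C_2 modulo C_3, and \<open>p\<close>, \<open>q\<close> span C_3
  modulo C_4. As \<open>lcs 5\<close> is C_6 = 0, every product with a factor in C_5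
  vanishes.\<close>

definition "c = x \<star> y"
definition "p = c \<star> x"
definition "q = c \<star> y"

lemma xy: "x \<star> y = c" "y \<star> x = - c" "c \<star> x = p" "x \<star> c = - p" "c \<star> y = q" "y \<star> c = - q"
  using mul_anticommute[of y x] mul_anticommute[of x c] mul_anticommute[of y c]
  by (simp_all add: c_def p_def q_def)

lemma c_mem: "c \<in> lcs 1"
  using lcs_mul[of x 0 y] by (simp add: c_def)

lemma lcs_Suc_mul: "u \<in> lcs n \<Longrightarrow> Suc n = m \<Longrightarrow> u \<star> v \<in> lcs m \<and> v \<star> u \<in> lcs m"
  using lcs_mul mul_lcs by blast

lemma p_mem: "p \<in> lcs 2" and q_mem: "q \<in> lcs 2"
  using lcs_Suc_mul[OF c_mem] by (simp_all add: p_def q_def)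

lemma mul_mem:
  "u \<in> lcs 1 \<Longrightarrow> u \<star> v \<in> lcs 2" "u \<in> lcs 1 \<Longrightarrow> v \<star> u \<in> lcs 2"
  "u \<in> lcs 2 \<Longrightarrow> u \<star> v \<in> lcs 3" "u \<in> lcs 2 \<Longrightarrow> v \<star> u \<in> lcs 3"
  "u \<in> lcs 3 \<Longrightarrow> u \<star> v \<in> lcs 4" "u \<in> lcs 3 \<Longrightarrow> v \<star> u \<in> lcs 4"
  using lcs_Suc_mul[of u 1 2] lcs_Suc_mul[of u 2 3] lcs_Suc_mul[of u 3 4] by simp_all

lemma lcs_4_mul [simp]: "u \<in> lcs 4 \<Longrightarrow> u \<star> v = 0" "u \<in> lcs 4 \<Longrightarrow> v \<star> u = 0"
  using lcs_Suc_mul[of u 4 5 v] lcs_5 by auto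

lemma lcs_3_mul [simp]:
  "u \<in> lcs 3 \<Longrightarrow> (u \<star> v) \<star> w = 0" "u \<in> lcs 3 \<Longrightarrow> (v \<star> u) \<star> w = 0"
  "u \<in> lcs 3 \<Longrightarrow> w \<star> (u \<star> v) = 0" "u \<in> lcs 3 \<Longrightarrow> w \<star> (v \<star> u) = 0"
  by (simp_all add: mul_mem)

lemma pq_mul_mem [simp]: "p \<star> v \<in> lcs 3" "q \<star> v \<in> lcs 3" "v \<star> p \<in> lcs 3" "v \<star> q \<in> lcs 3"
  by (simp_all add: mul_mem p_mem q_mem)

section \<open>Spanning sets for the factors of the lower central series\<close>

lemma UNIV_induct:
  assumes "subspace P" "x \<in> P" "y \<in> P" "lcs 1 \<subseteq> P"
  shows "u \<in> P"
  using span_minimal[of "{x, y} \<union> lcs 1" P] generators assms by auto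

lemma lcs_1_induct:
  assumes P: "subspace P" "c \<in> P" "lcs 2 \<subseteq> P" and "u \<in> lcs 1"
  shows "u \<in> P"
proof -
  have "lcs 1 \<subseteq> P"
    by (rule lcs_1_minimal[OF generators P(1,3)])
      (use P in \<open>auto simp: xy mul_self subspace_0 subspace_neg\<close>)
  then show ?thesis
    using assms(4) by blast
qed

text \<open>C_3 is spanned by brackets of C_2 with A. Modulo C_4 the first factor may be taken to be
  \<open>c\<close> and the second \<open>x\<close> or \<open>y\<close>, since [c,c] = 0 and [c,C_3]
  lies in C_4.\<close>

lemma lcs_2_induct:
  assumes P: "subspace P" "p \<in> P" "q \<in> P" "lcs 3 \<subseteq> P" and "u \<in> lcs 2"
  shows "u \<in> P"
proof -
  have sub: "lcs 2 \<subseteq> {v. c \<star> v \<in> P}"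
    using P(4) mul_mem(4) by blast
  have "lcs 1 \<subseteq> {v. c \<star> v \<in> P}"
    using lcs_1_induct[OF subspace_left_mul[OF P(1)] _ sub] P(1)
    by (auto simp: mul_self subspace_0)
  then have c: "c \<star> v \<in> P" for v
    using UNIV_induct[OF subspace_left_mul[OF P(1)], of c v] P xy by simp
  have "a \<star> b \<in> P" if "a \<in> lcs 1" for a b
    using lcs_1_induct[OF subspace_mul_into[OF P(1)] _ _ that] c P mul_mem by blast
  then have "product_subspace (lcs 1) UNIV \<subseteq> P"
    by (intro product_subspace_minimal[OF P(1)])
  then show ?thesis
    using assms by (auto simp: numeral_2_eq_2 lcs.simps(2)[of "Suc 0"])
qed

text \<open>C_4 = [C_3, A], and A contains \<open>c\<close>, \<open>p\<close>, \<open>q\<close>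
  besides \<open>x\<close> and \<open>y\<close>. The assumptions \<open>pq\<close> push brackets
  with those into C_5, leaving the four listed products.\<close>

lemma lcs_3_induct:
  assumes P: "subspace P" "p \<star> x \<in> P" "p \<star> y \<in> P" "q \<star> x \<in> P" "q \<star> y \<in> P" "lcs 4 \<subseteq> P"
    and pq: "p \<star> c \<in> lcs 4" "q \<star> c \<in> lcs 4" "p \<star> q = 0" and "u \<in> lcs 3"
  shows "u \<in> P"
proof -
  have qp: "q \<star> p = 0"
    using pq mul_anticommute[of q p] by simp
  have sub: "lcs 3 \<subseteq> {v. w \<star> v \<in> lcs 4}" for w
    using mul_mem(6) by blast
  have "lcs 2 \<subseteq> {v. p \<star> v \<in> lcs 4}"
    using lcs_2_induct[OF subspace_left_mul[OF subspace_lcs] _ _ sub] pq by (auto simp: mul_self)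
  then have "lcs 1 \<subseteq> {v. p \<star> v \<in> lcs 4}"
    using lcs_1_induct[OF subspace_left_mul[OF subspace_lcs]] pq by blast
  then have p: "p \<star> v \<in> P" for v
    using UNIV_induct[OF subspace_left_mul[OF P(1)], of p v] P by blast
  have "lcs 2 \<subseteq> {v. q \<star> v \<in> lcs 4}"
    using lcs_2_induct[OF subspace_left_mul[OF subspace_lcs] _ _ sub] qp by (auto simp: mul_self)
  then have "lcs 1 \<subseteq> {v. q \<star> v \<in> lcs 4}"
    using lcs_1_induct[OF subspace_left_mul[OF subspace_lcs]] pq by blast
  then have q: "q \<star> v \<in> P" for v
    using UNIV_induct[OF subspace_left_mul[OF P(1)], of q v] P by blast
  have "a \<star> b \<in> P" if "a \<in> lcs 2" for a b
    using lcs_2_induct[OF subspace_mul_into[OF P(1)] _ _ _ that] p q P mul_mem by blast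
  then have "product_subspace (lcs 2) UNIV \<subseteq> P"
    by (intro product_subspace_minimal[OF P(1)])
  then show ?thesis
    using assms by (auto simp: numeral_3_eq_3 numeral_2_eq_2 lcs.simps(2)[of "Suc (Suc 0)"])
qed

text \<open>C_2 is spanned by \<open>c\<close>, \<open>p\<close>, \<open>q\<close> and C_4, so it
  suffices that each of these is annihilated by C_4.\<close>

lemma lcs_3_mul_lcs_1:
  assumes c: "\<And>r. r \<in> lcs 3 \<Longrightarrow> r \<star> c = 0" and p: "\<And>r. r \<in> lcs 3 \<Longrightarrow> r \<star> p = 0"
    and q: "\<And>r. r \<in> lcs 3 \<Longrightarrow> r \<star> q = 0" and 3: "\<And>r s. r \<in> lcs 3 \<Longrightarrow> s \<in> lcs 3 \<Longrightarrow> r \<star> s = 0"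
    and "r \<in> lcs 3" "w \<in> lcs 1"
  shows "r \<star> w = 0"
proof -
  have "r \<star> v \<in> {0}" if "v \<in> lcs 2" for v
    using lcs_2_induct[OF subspace_left_mul[OF subspace_single_0] _ _ _ that, of r] assms by blast
  then show ?thesis
    using lcs_1_induct[OF subspace_left_mul[OF subspace_single_0] _ _ assms(6), of r] assms by blast
qed

text \<open>A vanishing Jacobian expresses [c,w] through [[y,w],x] and [[w,x],y], which lie in C_5
  for \<open>w\<close> in C_3.\<close>

lemma jacobian_mem: "jacobian x y p = 0 \<Longrightarrow> c \<star> p \<in> lcs 4" "jacobian x y q = 0 \<Longrightarrow> c \<star> q \<in> lcs 4"
proof -
  have "c \<star> w = - ((y \<star> w) \<star> x + (w \<star> x) \<star> y)" if "jacobian x y w = 0" for w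
    using that by (simp only: jacobian_def xy add.assoc eq_neg_iff_add_eq_0)
  then show "jacobian x y p = 0 \<Longrightarrow> c \<star> p \<in> lcs 4" "jacobian x y q = 0 \<Longrightarrow> c \<star> q \<in> lcs 4"
    by (auto intro!: subspace_neg subspace_add mul_mem(5) simp del: minus_add_distrib)
qed

text \<open>The Jacobian is trilinear and alternating, and A is spanned by \<open>x\<close>,
  \<open>y\<close>, \<open>c\<close>, \<open>p\<close>, \<open>q\<close> and C_4. A Jacobian with an
  argument in C_4 vanishes, so finitely many triples remain.\<close>

lemma jacobian_eq_zero:
  assumes py: "p \<star> y = q \<star> x" and J: "jacobian x y p = 0" "jacobian x y q = 0"
    and pq: "p \<star> q = 0" and 31: "\<And>r w. r \<in> lcs 3 \<Longrightarrow> w \<in> lcs 1 \<Longrightarrow> r \<star> w = 0"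
  shows "jacobian u v w = 0"
proof -
  have 13: "w \<star> r = 0" if "r \<in> lcs 3" "w \<in> lcs 1" for r w
    using 31[OF that] mul_anticommute[of w r] by simp
  have mem1: "p \<in> lcs 1" "q \<in> lcs 1" "a \<star> b \<in> lcs 1" for a b
    using p_mem q_mem lcs_antimono[of 1 2] lcs_mul[of a 0 b] by auto
  have J3: "jacobian r a b = 0" if "r \<in> lcs 3" for r a b
    using that mem1 by (simp add: jacobian_def 13)
  have perm: "jacobian a b d = 0 \<and> jacobian b d a = 0 \<and> jacobian d a b = 0 \<and>
      jacobian b a d = 0 \<and> jacobian a d b = 0 \<and> jacobian d b a = 0"
    if "jacobian a b d = 0" for a b d
    using that jacobian_cyclic[of a b d] jacobian_cyclic[of b d a] jacobian_swap[of a b d]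
      jacobian_swap[of b d a] jacobian_swap[of d a b] by simp
  have rep: "jacobian a a b = 0" for a b
    using mul_anticommute[of a b] by (simp add: jacobian_def mul_self minus_mul)
  have "c \<star> p \<in> lcs 4" "c \<star> q \<in> lcs 4"
    using jacobian_mem J by blast+
  then have cpq: "(c \<star> p) \<star> t = 0" "(c \<star> q) \<star> t = 0" "(p \<star> c) \<star> t = 0" "(q \<star> c) \<star> t = 0" for t
    using mul_anticommute[of p c] mul_anticommute[of q c] by (simp_all add: minus_mul)
  have "q \<star> p = 0"
    using pq mul_anticommute[of q p] by simp
  \<comment> \<open>Five elements form ten triples; two are covered by \<open>J\<close>, the other
    eight follow here.\<close>
  then have ten: "jacobian x y c = 0" "jacobian x c p = 0" "jacobian x c q = 0" "jacobian x p q = 0"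
    "jacobian y c p = 0" "jacobian y c q = 0" "jacobian y p q = 0" "jacobian c p q = 0"
    using py pq by (simp_all add: jacobian_def mul_self xy minus_mul cpq 31 13 c_mem mem1 del: One_nat_def)
  let ?G = "{x, y, c, p, q}"
  note perms = perm[OF J(1)] perm[OF J(2)] perm[OF ten(1)] perm[OF ten(2)] perm[OF ten(3)]
      perm[OF ten(4)] perm[OF ten(5)] perm[OF ten(6)] perm[OF ten(7)] perm[OF ten(8)] perm[OF rep]
  have G: "jacobian a b d = 0" if "a \<in> ?G" "b \<in> ?G" "d \<in> ?G" for a b d
    using that by (elim insertE emptyE) (simp_all only: perms)
  have ext: "u \<in> P" if P: "subspace P" "?G \<subseteq> P" "lcs 3 \<subseteq> P" for u P
  proof (rule UNIV_induct[OF P(1)])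
    have "lcs 2 \<subseteq> P"
      using lcs_2_induct[OF P(1) _ _ P(3)] P(2) by blast
    then show "lcs 1 \<subseteq> P"
      using lcs_1_induct[OF P(1)] P(2) by blast
  qed (use P in auto)
  have J_ext: "jacobian u b d = 0" if "\<And>a. a \<in> ?G \<Longrightarrow> jacobian a b d = 0" for u b d
  proof -
    have "u \<in> {u. jacobian u b d = 0}"
      by (rule ext[OF subspace_jacobian_kernel]; intro subsetI CollectI; erule that J3)
    then show ?thesis ..
  qed
  \<comment> \<open>One argument at a time is freed: linearity in the first position makes it
    arbitrary, then a cyclic rotation brings the next argument to the front.\<close>
  have 1: "jacobian u b d = 0" if "b \<in> ?G" "d \<in> ?G" for u b d
    by (rule J_ext) (rule G[OF _ that])
  have *: "jacobian a u b = 0" if "b \<in> ?G" "a \<in> ?G" for a u b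
    using perm[OF 1[OF that, of u]] by blast
  have 2: "jacobian a u b = 0" if "b \<in> ?G" for a u b
    by (rule J_ext) (rule *[OF that])
  have "jacobian a v w = 0" if "a \<in> ?G" for a
    using perm[OF 2[OF that, of v w]] by blast
  then show ?thesis
    by (rule J_ext)
qed

section \<open>Either identity forces the Jacobi identity\<close>

lemma eq_minus_self: "v = - v \<Longrightarrow> v = 0" for v :: 'b
proof -
  assume "v = - v"
  then have "v + v = 0"
    by (simp only: eq_neg_iff_add_eq_0)
  then show "v = 0"
    using scale_left_distrib[of 1 1 v] by (intro scale_2_eq_zero[of v]) simp
qed

text \<open>Instances of the identity at the low-degree products establish, degree by degree, the
  hypotheses of \<open>jacobian_eq_zero\<close>, the last being [C_4, C_2] = 0.\<close>

lemma cd_imp_lie: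
  assumes cd_identity
  shows "jacobian u v w = 0"
proof -
  have cd: "((u \<star> v) \<star> a) \<star> b - ((u \<star> v) \<star> b) \<star> a =
      ((u \<star> a) \<star> b - (u \<star> b) \<star> a) \<star> v + u \<star> ((v \<star> a) \<star> b - (v \<star> b) \<star> a)" for u v a b
    using assms by (simp add: cd_identity_def commutator_op_def)
  \<comment> \<open>The two sides of this instance are opposite, which is where the characteristic
    enters.\<close>
  have "p \<star> y - q \<star> x = - (p \<star> y - q \<star> x)"
    using cd[of x y x y] mul_anticommute[of x q] by (simp add: xy mul_self minus_mul mul_minus)
  from eq_minus_self[OF this] have py: "p \<star> y = q \<star> x"
    by simp
  have pc: "p \<star> c = (p \<star> x) \<star> y - (q \<star> x) \<star> x"
    using cd[of x y c x] mul_anticommute[of x "q \<star> x"]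
    by (simp add: xy mul_self minus_mul mul_minus) (simp add: algebra_simps)
  have qc: "q \<star> c = (p \<star> y) \<star> y - (q \<star> y) \<star> x"
    using cd[of x y c y] mul_anticommute[of x "q \<star> y"]
    by (simp add: xy mul_self minus_mul mul_minus) (simp add: algebra_simps)
  have pc4: "p \<star> c \<in> lcs 4" and qc4: "q \<star> c \<in> lcs 4"
    unfolding pc qc by (simp_all add: subspace_diff mul_mem)
  have cp4: "c \<star> p \<in> lcs 4" and cq4: "c \<star> q \<in> lcs 4"
    using pc4 qc4 mul_anticommute[of c p] mul_anticommute[of c q] by (simp_all add: subspace_neg)
  have J: "jacobian x y p = 0" "jacobian x y q = 0"
    using mul_anticommute[of c p] mul_anticommute[of c q] mul_anticommute[of y p] mul_anticommute[of y q]
    by (simp_all add: jacobian_def xy pc qc py minus_mul)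
  \<comment> \<open>In this instance every term other than [q,p] falls into C_6 = 0.\<close>
  have pq: "p \<star> q = 0"
    using cd[of x y p y] mul_anticommute[of p q] cp4
    by (simp add: xy mul_self minus_mul mul_minus diff_mul mul_diff)
  \<comment> \<open>For \<open>t\<close> and \<open>s\<close> among \<open>x\<close>,
    \<open>y\<close> the product [[c,t],s] runs through the four spanning products of C_4; the
    instance again equates it, bracketed with \<open>c\<close>, to its own negative.\<close>
  have "((c \<star> t) \<star> s) \<star> c = 0" if "c \<star> t \<in> lcs 2" "c \<star> s \<in> lcs 2" "(t \<star> s) \<star> c = 0" "(c \<star> t) \<star> c \<in> lcs 4" "(c \<star> s) \<star> c \<in> lcs 4" for t s
  proof (rule eq_minus_self)
    show "((c \<star> t) \<star> s) \<star> c = - (((c \<star> t) \<star> s) \<star> c)"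
      using cd[of c t c s] that mul_anticommute[of t c] mul_anticommute[of c "(c \<star> t) \<star> s"]
      by (simp add: mul_self minus_mul mul_minus diff_mul mul_diff)
  qed
  note this[of x x] this[of x y] this[of y x] this[of y y]
  then have pqc: "(p \<star> x) \<star> c = 0" "(p \<star> y) \<star> c = 0" "(q \<star> x) \<star> c = 0" "(q \<star> y) \<star> c = 0"
    by (simp_all add: xy mul_self minus_mul p_mem q_mem pc4 qc4)
  have 3: "subspace P \<Longrightarrow> p \<star> x \<in> P \<Longrightarrow> p \<star> y \<in> P \<Longrightarrow> q \<star> x \<in> P \<Longrightarrow> q \<star> y \<in> P \<Longrightarrow> lcs 4 \<subseteq> P \<Longrightarrow> lcs 3 \<subseteq> P" for P
    using lcs_3_induct[of P] pc4 qc4 pq by blast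
  have "lcs 3 \<subseteq> {r. \<forall>s\<in>{c}. r \<star> s \<in> {0}}"
    by (rule 3) (auto intro!: subspaceI simp: bilinear_simps pqc)
  then have rc: "r \<star> c = 0" if "r \<in> lcs 3" for r
    using that by blast
  then have cr: "c \<star> r = 0" if "r \<in> lcs 3" for r
    using that mul_anticommute[of c r] by simp
  have pr: "p \<star> r = 0" if "r \<in> lcs 3" for r
    using cd[of x y r x] that cr[OF that] by (simp add: xy mul_self minus_mul)
  have qr: "q \<star> r = 0" if "r \<in> lcs 3" for r
    using cd[of x y r y] that cr[OF that] by (simp add: xy mul_self minus_mul)
  \<comment> \<open>With \<open>r\<close> in C_4 this annihilates the same four products by
    \<open>r\<close>, hence [C_4, C_4] = 0.\<close>
  have *: "((c \<star> t) \<star> s) \<star> r = 0" if "r \<in> lcs 3" "(c \<star> t) \<star> r = 0" "(c \<star> s) \<star> r = 0" "(t \<star> s) \<star> r = 0" for r t s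
    using cd[of c t r s] that cr[OF that(1)] by simp
  have "lcs 3 \<subseteq> {r. \<forall>s\<in>lcs 3. r \<star> s \<in> {0}}"
    using *[of _ x x] *[of _ x y] *[of _ y x] *[of _ y y]
    by (intro 3) (auto intro!: subspaceI simp: bilinear_simps xy mul_self cr pr qr)
  then have 33: "r \<star> s = 0" if "r \<in> lcs 3" "s \<in> lcs 3" for r s
    using that by blast
  have rp: "r \<star> p = 0" if "r \<in> lcs 3" for r
    using pr[OF that] mul_anticommute[of r p] by simp
  have rq: "r \<star> q = 0" if "r \<in> lcs 3" for r
    using qr[OF that] mul_anticommute[of r q] by simp
  show ?thesis
    using jacobian_eq_zero[OF py J pq lcs_3_mul_lcs_1[OF rc rp rq 33]] .
qed

text \<open>The kernel of J(x,y,-) contains \<open>c\<close> and is stable under multiplication by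
  \<open>x\<close> and \<open>y\<close>, so it contains \<open>p\<close>, \<open>q\<close> and the
  products spanning C_4. The remaining brackets with C_4 come from further instances and
  polarisations.\<close>

lemma malcev_imp_lie:
  assumes malcev_identity
  shows "jacobian u v w = 0"
proof -
  have m: "jacobian a b (a \<star> d) = jacobian a b d \<star> a" for a b d
    using assms by (simp add: malcev_identity_def)
  note polar = malcev_polar[OF assms]
  have neg: "jacobian a b (- d) = - jacobian a b d" for a b d
    by (simp add: jacobian_def bilinear_simps)
  have rep: "jacobian a b b = 0" for a b
    using mul_anticommute[of b a] by (simp add: jacobian_def mul_self minus_mul)
  have Jc: "jacobian x y c = 0"
    using m[of x y y] rep[of x y] by (simp add: xy)
  then have py: "p \<star> y = q \<star> x"
    by (simp add: jacobian_def mul_self xy minus_mul)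
  have Jx: "jacobian x y (w \<star> x) = 0" if "jacobian x y w = 0" for w
    using m[of x y w] that neg[of x y "x \<star> w"] mul_anticommute[of w x] by simp
  have Jy: "jacobian x y (w \<star> y) = 0" if "jacobian x y w = 0" for w
    using m[of y x w] that neg[of y x "y \<star> w"] mul_anticommute[of w y] jacobian_swap[of x y] by simp
  have J: "jacobian x y p = 0" "jacobian x y q = 0"
    using Jx[OF Jc] Jy[OF Jc] by (simp_all add: xy)
  \<comment> \<open>For \<open>r\<close> in C_4 the other two terms of J(x,y,r) lie in C_6 = 0,
    leaving [c,r].\<close>
  have cr: "c \<star> r = 0" if "r \<in> lcs 3" "jacobian x y r = 0" for r
    using that by (simp add: jacobian_def xy)
  have cpq: "c \<star> (p \<star> x) = 0" "c \<star> (p \<star> y) = 0" "c \<star> (q \<star> x) = 0" "c \<star> (q \<star> y) = 0"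
    using J by (auto intro!: cr Jx Jy)
  have cp4: "c \<star> p \<in> lcs 4" and cq4: "c \<star> q \<in> lcs 4"
    using jacobian_mem J by blast+
  have pc4: "p \<star> c \<in> lcs 4" and qc4: "q \<star> c \<in> lcs 4"
    using cp4 cq4 mul_anticommute[of p c] mul_anticommute[of q c] by (simp_all add: subspace_neg)
  have pq: "p \<star> q = 0"
    using m[of c x y] jacobian_cyclic[of x y c] jacobian_cyclic[of y c x] Jc
      mul_anticommute[of "x \<star> q" c] mul_anticommute[of x q] qc4 cpq
    by (simp add: xy) (simp add: jacobian_def xy mul_minus)
  have 3: "subspace P \<Longrightarrow> p \<star> x \<in> P \<Longrightarrow> p \<star> y \<in> P \<Longrightarrow> q \<star> x \<in> P \<Longrightarrow> q \<star> y \<in> P \<Longrightarrow> lcs 4 \<subseteq> P \<Longrightarrow> lcs 3 \<subseteq> P" for P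
    using lcs_3_induct[of P] pc4 qc4 pq by blast
  have "lcs 3 \<subseteq> {r. \<forall>s\<in>{c}. s \<star> r \<in> {0}}"
    by (rule 3) (auto intro!: subspaceI simp: bilinear_simps cpq)
  then have cr: "c \<star> r = 0" if "r \<in> lcs 3" for r
    using that by blast
  then have rc: "r \<star> c = 0" if "r \<in> lcs 3" for r
    using that mul_anticommute[of r c] by simp
  have qp: "q \<star> p = 0"
    using pq mul_anticommute[of q p] by simp
  have Jpq: "jacobian x c p = 0" "jacobian x c q = 0" "jacobian y c p = 0" "jacobian y c q = 0"
    using cp4 cq4 by (simp_all add: jacobian_def xy minus_mul mul_self pq qp rc)
  \<comment> \<open>These turn Malcev instances with first arguments \<open>x\<close>,
    \<open>c\<close> or \<open>y\<close>, \<open>c\<close> into statements about [p,r] and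
    [q,r].\<close>
  have Jxc: "jacobian x c r = - (p \<star> r)" "jacobian y c r = - (q \<star> r)" if "r \<in> lcs 3" for r
    using that by (simp_all add: jacobian_def xy minus_mul cr)
  have 1: "p \<star> (x \<star> p) = 0" "p \<star> (x \<star> q) = 0" "q \<star> (y \<star> p) = 0" "q \<star> (y \<star> q) = 0"
    using m[of x c p] m[of x c q] m[of y c p] m[of y c q] Jpq Jxc by simp_all
  have 2: "p \<star> (y \<star> w) = - (q \<star> (x \<star> w))" if "w = p \<or> w = q" for w
  proof -
    have "- (p \<star> (y \<star> w)) + - (q \<star> (x \<star> w)) = 0"
      using polar[of x c y w] Jpq that by (auto simp: Jxc)
    then have "- (p \<star> (y \<star> w)) = - (- (q \<star> (x \<star> w)))"
      by (simp only: eq_neg_iff_add_eq_0)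
    then show ?thesis
      by (simp only: neg_equal_iff_equal)
  qed
  have swap: "x \<star> p = - (p \<star> x)" "x \<star> q = - (q \<star> x)" "y \<star> p = - (q \<star> x)" "y \<star> q = - (q \<star> y)"
    using mul_anticommute[of x p] mul_anticommute[of x q] mul_anticommute[of y p] mul_anticommute[of y q] py
    by simp_all
  have prs: "p \<star> (p \<star> x) = 0" "p \<star> (p \<star> y) = 0" "p \<star> (q \<star> x) = 0" "p \<star> (q \<star> y) = 0"
    "q \<star> (p \<star> x) = 0" "q \<star> (p \<star> y) = 0" "q \<star> (q \<star> x) = 0" "q \<star> (q \<star> y) = 0"
    using 1 2[of p] 2[of q] by (simp_all add: swap py mul_minus)
  have "lcs 3 \<subseteq> {r. \<forall>s\<in>{p,q}. s \<star> r \<in> {0}}"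
    by (rule 3) (auto intro!: subspaceI simp: bilinear_simps prs)
  then have pr: "p \<star> r = 0" "q \<star> r = 0" if "r \<in> lcs 3" for r
    using that by auto
  then have rp: "r \<star> p = 0" "r \<star> q = 0" if "r \<in> lcs 3" for r
    using that mul_anticommute[of r p] mul_anticommute[of r q] by simp_all
  have Jpxy: "jacobian p x y = 0" "jacobian q x y = 0" "jacobian q y x = 0"
    using J jacobian_cyclic[of p x y] jacobian_cyclic[of q x y] jacobian_cyclic[of x y q]
      jacobian_swap[of x q y] jacobian_cyclic[of x y p] jacobian_cyclic[of x q y] by simp_all
  \<comment> \<open>Since \<open>py\<close> identifies [p,y] with [q,x], C_4 is spanned modulo C_5
    by [p,x], [q,x] and [q,y]; their three pairwise brackets are treated in turn.\<close>
  have "(p \<star> x) \<star> (p \<star> y) = 0"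
    using m[of p x y] Jpxy rp by (simp add: jacobian_def)
  moreover have "(q \<star> y) \<star> (q \<star> x) = 0"
    using m[of q y x] Jpxy rp by (simp add: jacobian_def)
  moreover have "(p \<star> x) \<star> (q \<star> y) = 0"
    using polar[of p x q y] Jpxy rp by (simp add: jacobian_def py mul_self)
  ultimately have rr: "(p \<star> x) \<star> (q \<star> x) = 0" "(q \<star> x) \<star> (p \<star> x) = 0" "(q \<star> y) \<star> (q \<star> x) = 0"
      "(q \<star> x) \<star> (q \<star> y) = 0" "(p \<star> x) \<star> (q \<star> y) = 0" "(q \<star> y) \<star> (p \<star> x) = 0"
    using mul_anticommute[of "q \<star> x"  "p \<star> x"] mul_anticommute[of "q \<star> x" "q \<star> y"]
      mul_anticommute[of "q \<star> y" "p \<star> x"] py by simp_all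
  have "lcs 3 \<subseteq> {r. \<forall>s\<in>{p \<star> x, q \<star> x, q \<star> y}. s \<star> r \<in> {0}}"
    by (rule 3) (auto intro!: subspaceI simp: bilinear_simps rr py mul_self)
  then have "lcs 3 \<subseteq> {r. \<forall>s\<in>lcs 3. r \<star> s \<in> {0}}"
    by (intro 3) (auto intro!: subspaceI simp: bilinear_simps py)
  then have 33: "r \<star> s = 0" if "r \<in> lcs 3" "s \<in> lcs 3" for r s
    using that by blast
  show ?thesis
    using jacobian_eq_zero[OF py J pq lcs_3_mul_lcs_1[OF rc rp 33]] .
qed

end

section \<open>Three generators and class four\<close>

text \<open>
  The generators are chosen so that \<open>x3\<close> spans the radical of the alternating form
  \<open>A / C\<^sub>2 \<times> A / C\<^sub>2 \<rightarrow> C\<^sub>2 / C\<^sub>3\<close> induced by the product.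
\<close>

locale class_four_algebra = anticommutative_algebra +
  fixes x1 x2 x3 c u z and l1 l2 l3 n1 n2 n3
  assumes generators: "span ({x1, x2, x3} \<union> lcs 1) = UNIV"
    and lcs_4: "lcs 4 = {0}"
    and x12: "x1 \<star> x2 = c" and x13: "x1 \<star> x3 \<in> lcs 2" and x23: "x2 \<star> x3 \<in> lcs 2"
    and lcs_1_span: "lcs 1 \<subseteq> span (insert c (lcs 2))"
    and lcs_2_span: "lcs 2 \<subseteq> span (insert u (lcs 3))"
    and u_mem: "u \<in> lcs 2"
    and cx: "c \<star> x1 - scale l1 u \<in> lcs 3" "c \<star> x2 - scale l2 u \<in> lcs 3" "c \<star> x3 - scale l3 u \<in> lcs 3"
    and ux: "u \<star> x1 = scale n1 z" "u \<star> x2 = scale n2 z" "u \<star> x3 = scale n3 z"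
    and z_nonzero: "z \<noteq> 0"
    and l_nonzero: "l1 \<noteq> 0 \<or> l2 \<noteq> 0 \<or> l3 \<noteq> 0"
    and n_nonzero: "u \<star> c = 0 \<Longrightarrow> n1 \<noteq> 0 \<or> n2 \<noteq> 0 \<or> n3 \<noteq> 0"
    and two_nonzero: "(2::'a) \<noteq> 0"
begin

lemma lcs_3_mul [simp]: "v \<in> lcs 3 \<Longrightarrow> v \<star> w = 0" "v \<in> lcs 3 \<Longrightarrow> w \<star> v = 0"
  using lcs_mul[of v 3 w] mul_lcs[of v 3 w] lcs_4 by (auto simp: eval_nat_numeral)

lemma c_mem: "c \<in> lcs 1"
  using lcs_mem(1)[of x1 x2] by (simp add: x12)

section \<open>Products in coordinates modulo C_2\<close>

definition rep :: "'b \<Rightarrow> 'a \<Rightarrow> 'a \<Rightarrow> 'a \<Rightarrow> bool"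
  where "rep v a1 a2 a3 \<longleftrightarrow> v - (scale a1 x1 + scale a2 x2 + scale a3 x3) \<in> lcs 1"

lemma rep_exists: obtains a1 a2 a3 where "rep v a1 a2 a3"
proof -
  have "v \<in> span (insert x1 (insert x2 (insert x3 (lcs 1))))"
    using generators by simp
  then obtain a1 a2 a3 where "v - scale a1 x1 - scale a2 x2 - scale a3 x3 \<in> span (lcs 1)"
    by (auto simp: span_breakdown_eq)
  then have "v - scale a1 x1 - scale a2 x2 - scale a3 x3 \<in> lcs 1"
    by (simp only: span_eq_iff[THEN iffD2] subspace_lcs)
  then show ?thesis
    using that[of a1 a2 a3] by (simp add: rep_def algebra_simps)
qed

text \<open>As [x1,x3] and [x2,x3] lie in C_3, only the coefficient of [x1,x2] survives modulo C_3.
  Call this alternating form omega.\<close>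

lemma rep_mul:
  assumes "rep v a1 a2 a3" "rep w b1 b2 b3"
  shows "v \<star> w - scale (a1 * b2 - a2 * b1) c \<in> lcs 2"
proof -
  define r where "r = v - (scale a1 x1 + scale a2 x2 + scale a3 x3)"
  define s where "s = w - (scale b1 x1 + scale b2 x2 + scale b3 x3)"
  have rs: "r \<in> lcs 1" "s \<in> lcs 1"
    using assms by (simp_all add: r_def s_def rep_def)
  have "v \<star> w = (v - r) \<star> (w - s) + ((v - r) \<star> s + r \<star> w)"
    by (simp add: bilinear_simps)
  moreover have "(v - r) \<star> (w - s) - scale (a1 * b2 - a2 * b1) c =
      scale (a1 * b3 - a3 * b1) (x1 \<star> x3) + scale (a2 * b3 - a3 * b2) (x2 \<star> x3)"
    using mul_anticommute[of x2 x1] mul_anticommute[of x3 x1] mul_anticommute[of x3 x2]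
    by (simp add: r_def s_def bilinear_simps mul_self x12 scale_left_diff_distrib scale_right_distrib algebra_simps)
  ultimately have "v \<star> w - scale (a1 * b2 - a2 * b1) c =
      scale (a1 * b3 - a3 * b1) (x1 \<star> x3) + scale (a2 * b3 - a3 * b2) (x2 \<star> x3) + ((v - r) \<star> s + r \<star> w)"
    by (simp add: algebra_simps)
  then show ?thesis
    using rs by (simp only:) (intro subspace_add subspace_scale subspace_lcs lcs_mem x13 x23)
qed

lemma c_mul_lcs_1: "r \<in> lcs 1 \<Longrightarrow> c \<star> r \<in> lcs 3"
proof -
  have "insert c (lcs 2) \<subseteq> {r. c \<star> r \<in> lcs 3}"
    using lcs_mem by (auto simp: mul_self)
  then have "span (insert c (lcs 2)) \<subseteq> {r. c \<star> r \<in> lcs 3}"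
    by (rule span_minimal[OF _ subspace_left_mul[OF subspace_lcs]])
  then show "r \<in> lcs 1 \<Longrightarrow> c \<star> r \<in> lcs 3"
    using lcs_1_span by blast
qed

text \<open>C_2 modulo C_3 is spanned by the single element \<open>c\<close>, and [c,c] = 0.\<close>

lemma lcs_1_mul_lcs_1:
  assumes "r \<in> lcs 1" "s \<in> lcs 1"
  shows "r \<star> s \<in> lcs 3"
proof -
  have "insert c (lcs 2) \<subseteq> {r. r \<star> s \<in> lcs 3}"
    using c_mul_lcs_1[OF assms(2)] lcs_mem by auto
  then have "span (insert c (lcs 2)) \<subseteq> {r. r \<star> s \<in> lcs 3}"
    by (rule span_minimal[OF _ subspace_right_mul[OF subspace_lcs]])
  then show ?thesis
    using lcs_1_span assms(1) by blast
qed

lemma rep_mul_mul: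
  assumes "w - scale k c \<in> lcs 2" "rep v a1 a2 a3"
  shows "w \<star> v - scale (k * (l1 * a1 + l2 * a2 + l3 * a3)) u \<in> lcs 3"
proof -
  define r where "r = v - (scale a1 x1 + scale a2 x2 + scale a3 x3)"
  have "w \<star> v - scale (k * (l1 * a1 + l2 * a2 + l3 * a3)) u =
      (w - scale k c) \<star> v + scale k (c \<star> r + (scale a1 (c \<star> x1 - scale l1 u) +
        scale a2 (c \<star> x2 - scale l2 u) + scale a3 (c \<star> x3 - scale l3 u)))"
    by (simp add: r_def bilinear_simps scale_right_distrib scale_left_distrib scale_right_diff_distrib algebra_simps)
  also have "\<dots> \<in> lcs 3"
    using assms(2) cx c_mul_lcs_1[of r] lcs_mem(4)[OF assms(1)]
    by (intro subspace_add subspace_scale subspace_lcs) (simp_all add: r_def rep_def)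
  finally show ?thesis .
qed

section \<open>The case [u,c] = 0: both identities as polynomial conditions\<close>

context
  assumes uc: "u \<star> c = 0"
begin

lemma u_mul_lcs_1: "r \<in> lcs 1 \<Longrightarrow> u \<star> r = 0"
proof -
  have "insert u (lcs 3) \<subseteq> {r. u \<star> r \<in> {0}}"
    by (auto simp: mul_self)
  then have "span (insert u (lcs 3)) \<subseteq> {r. u \<star> r \<in> {0}}"
    by (rule span_minimal[OF _ subspace_left_mul[OF subspace_single_0]])
  then have "insert c (lcs 2) \<subseteq> {r. u \<star> r \<in> {0}}"
    using lcs_2_span uc by auto
  then have "span (insert c (lcs 2)) \<subseteq> {r. u \<star> r \<in> {0}}"
    by (rule span_minimal[OF _ subspace_left_mul[OF subspace_single_0]])
  then show "r \<in> lcs 1 \<Longrightarrow> u \<star> r = 0"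
    using lcs_1_span by blast
qed

lemma lcs_1_mul_lcs_1_zero:
  assumes "r \<in> lcs 1" "s \<in> lcs 1"
  shows "r \<star> s = 0"
proof -
  have *: "t \<star> u = 0" if "t \<in> lcs 1" for t
    using u_mul_lcs_1[OF that] mul_anticommute[of t u] by simp
  have "insert u (lcs 3) \<subseteq> {s. c \<star> s \<in> {0}}"
    using *[OF c_mem] by auto
  then have "span (insert u (lcs 3)) \<subseteq> {s. c \<star> s \<in> {0}}"
    by (rule span_minimal[OF _ subspace_left_mul[OF subspace_single_0]])
  then have "insert c (lcs 2) \<subseteq> {s. c \<star> s \<in> {0}}"
    using lcs_2_span mul_self by auto
  then have "span (insert c (lcs 2)) \<subseteq> {s. c \<star> s \<in> {0}}"
    by (rule span_minimal[OF _ subspace_left_mul[OF subspace_single_0]])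
  then have cs: "c \<star> s = 0"
    using lcs_1_span assms by blast
  have sub: "subspace {r. r \<star> s = 0}"
    by (auto intro!: subspaceI simp: bilinear_simps)
  have "insert u (lcs 3) \<subseteq> {r. r \<star> s = 0}"
    using u_mul_lcs_1[OF assms(2)] by auto
  then have "span (insert u (lcs 3)) \<subseteq> {r. r \<star> s = 0}"
    by (rule span_minimal[OF _ sub])
  then have "insert c (lcs 2) \<subseteq> {r. r \<star> s = 0}"
    using lcs_2_span cs by auto
  then have "span (insert c (lcs 2)) \<subseteq> {r. r \<star> s = 0}"
    by (rule span_minimal[OF _ sub])
  then show ?thesis
    using lcs_1_span assms by blast
qed

text \<open>Let l and n be the linear forms on coordinates with coefficients \<open>l1\<close>,
  \<open>l2\<close>, \<open>l3\<close> and \<open>n1\<close>, \<open>n2\<close>, \<open>n3\<close>.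
  The product becomes omega(a,b) l(d) n(e) z, because \<open>u\<close> annihilates C_2.\<close>

lemma quadruple_product:
  assumes "rep a a1 a2 a3" "rep b b1 b2 b3" "rep d d1 d2 d3" "rep e e1 e2 e3"
  shows "((a \<star> b) \<star> d) \<star> e =
    scale ((a1 * b2 - a2 * b1) * (l1 * d1 + l2 * d2 + l3 * d3) * (n1 * e1 + n2 * e2 + n3 * e3)) z"
proof -
  let ?k = "(a1 * b2 - a2 * b1) * (l1 * d1 + l2 * d2 + l3 * d3)"
  let ?r = "e - (scale e1 x1 + scale e2 x2 + scale e3 x3)"
  let ?w = "(a \<star> b) \<star> d"
  have "?w - scale ?k u \<in> lcs 3"
    using rep_mul_mul[OF rep_mul[OF assms(1,2)] assms(3)] .
  then have "?w \<star> e = scale ?k (u \<star> e)"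
    using lcs_3_mul(1)[of "?w - scale ?k u" e] by (simp add: bilinear_simps)
  moreover have "u \<star> ?r = 0"
    using assms(4) by (intro u_mul_lcs_1) (simp add: rep_def)
  then have "u \<star> e = scale (n1 * e1 + n2 * e2 + n3 * e3) z"
    by (simp add: bilinear_simps ux scale_left_distrib algebra_simps)
  ultimately show ?thesis
    by simp
qed

lemma quadruple_product': 
  assumes "rep a a1 a2 a3" "rep b b1 b2 b3" "rep d d1 d2 d3" "rep e e1 e2 e3"
  shows "e \<star> ((a \<star> b) \<star> d) =
      scale (- ((a1 * b2 - a2 * b1) * (l1 * d1 + l2 * d2 + l3 * d3) * (n1 * e1 + n2 * e2 + n3 * e3))) z"
    "(d \<star> (a \<star> b)) \<star> e =
      scale (- ((a1 * b2 - a2 * b1) * (l1 * d1 + l2 * d2 + l3 * d3) * (n1 * e1 + n2 * e2 + n3 * e3))) z"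
  using quadruple_product[OF assms] mul_anticommute[of e "(a \<star> b) \<star> d"] mul_anticommute[of d "a \<star> b"]
  by (simp_all add: minus_mul)

text \<open>Every term is a multiple of the nonzero vector \<open>z\<close>, so the identity is an
  equation between the coefficients given by \<open>quadruple_product\<close>.\<close>

lemma cd_iff: "cd_identity \<longleftrightarrow> (\<forall>a1 a2 a3 b1 b2 b3 d1 d2 d3 e1 e2 e3.
  (d1 * e2 - d2 * e1) * (l1 * a1 + l2 * a2 + l3 * a3) * (n1 * b1 + n2 * b2 + n3 * b3)
  - (d1 * e2 - d2 * e1) * (l1 * b1 + l2 * b2 + l3 * b3) * (n1 * a1 + n2 * a2 + n3 * a3)
  = ((d1 * a2 - d2 * a1) * (l1 * b1 + l2 * b2 + l3 * b3)
    - (d1 * b2 - d2 * b1) * (l1 * a1 + l2 * a2 + l3 * a3)) * (n1 * e1 + n2 * e2 + n3 * e3)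
  - ((e1 * a2 - e2 * a1) * (l1 * b1 + l2 * b2 + l3 * b3)
    - (e1 * b2 - e2 * b1) * (l1 * a1 + l2 * a2 + l3 * a3)) * (n1 * d1 + n2 * d2 + n3 * d3))"
  (is "_ \<longleftrightarrow> (\<forall>a1 a2 a3 b1 b2 b3 d1 d2 d3 e1 e2 e3. ?P a1 a2 a3 b1 b2 b3 d1 d2 d3 e1 e2 e3)")
proof -
  have *: "commutator_op a b (d \<star> e) = commutator_op a b d \<star> e + d \<star> commutator_op a b e
      \<longleftrightarrow> ?P a1 a2 a3 b1 b2 b3 d1 d2 d3 e1 e2 e3"
    if r: "rep a a1 a2 a3" "rep b b1 b2 b3" "rep d d1 d2 d3" "rep e e1 e2 e3"
    for a b d e a1 a2 a3 b1 b2 b3 d1 d2 d3 e1 e2 e3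
    using z_nonzero
    by (simp add: commutator_op_def diff_mul mul_diff
        quadruple_product[OF r(3,4,1,2)] quadruple_product[OF r(3,4,2,1)]
        quadruple_product[OF r(3,1,2,4)] quadruple_product[OF r(3,2,1,4)]
        quadruple_product'(1)[OF r(4,1,2,3)] quadruple_product'(1)[OF r(4,2,1,3)]
        flip: scale_left_diff_distrib scale_left_distrib)
      (simp add: algebra_simps)
  have ex: "rep (scale a1 x1 + scale a2 x2 + scale a3 x3) a1 a2 a3" for a1 a2 a3
    by (simp add: rep_def)
  show ?thesis
  proof
    assume cd_identity
    then show "\<forall>a1 a2 a3 b1 b2 b3 d1 d2 d3 e1 e2 e3. ?P a1 a2 a3 b1 b2 b3 d1 d2 d3 e1 e2 e3"
      unfolding cd_identity_def by (intro allI *[OF ex ex ex ex, THEN iffD1]) blast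
  next
    assume P: "\<forall>a1 a2 a3 b1 b2 b3 d1 d2 d3 e1 e2 e3. ?P a1 a2 a3 b1 b2 b3 d1 d2 d3 e1 e2 e3"
    show cd_identity
      unfolding cd_identity_def
    proof (intro allI)
      fix a b d e
      obtain a1 a2 a3 where a: "rep a a1 a2 a3" by (rule rep_exists)
      obtain b1 b2 b3 where b: "rep b b1 b2 b3" by (rule rep_exists)
      obtain d1 d2 d3 where d: "rep d d1 d2 d3" by (rule rep_exists)
      obtain e1 e2 e3 where e: "rep e e1 e2 e3" by (rule rep_exists)
      show "commutator_op a b (d \<star> e) = commutator_op a b d \<star> e + d \<star> commutator_op a b e"
        by (rule *[OF a b d e, THEN iffD2]) (rule P[rule_format])
    qed
  qed
qed

text \<open>The term [[a,b],[a,d]] vanishes since [C_2, C_2] = 0, and the terms omega(d,a) l(b) n(a)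
  on the two sides cancel.\<close>

lemma malcev_iff: "malcev_identity \<longleftrightarrow> (\<forall>a1 a2 a3 b1 b2 b3 d1 d2 d3.
  (a1 * d2 - a2 * d1) * (l1 * a1 + l2 * a2 + l3 * a3) * (n1 * b1 + n2 * b2 + n3 * b3)
  = ((a1 * b2 - a2 * b1) * (l1 * d1 + l2 * d2 + l3 * d3)
    + (b1 * d2 - b2 * d1) * (l1 * a1 + l2 * a2 + l3 * a3)) * (n1 * a1 + n2 * a2 + n3 * a3))"
  (is "_ \<longleftrightarrow> (\<forall>a1 a2 a3 b1 b2 b3 d1 d2 d3. ?P a1 a2 a3 b1 b2 b3 d1 d2 d3)")
proof -
  have *: "jacobian a b (a \<star> d) = jacobian a b d \<star> a \<longleftrightarrow> ?P a1 a2 a3 b1 b2 b3 d1 d2 d3"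
    if r: "rep a a1 a2 a3" "rep b b1 b2 b3" "rep d d1 d2 d3"
    for a b d a1 a2 a3 b1 b2 b3 d1 d2 d3
    using z_nonzero
    by (simp add: jacobian_def add_mul lcs_1_mul_lcs_1_zero[OF lcs_mem(1) lcs_mem(1)]
        quadruple_product[OF r(1,2,3,1)] quadruple_product[OF r(2,3,1,1)]
        quadruple_product[OF r(3,1,2,1)] quadruple_product[OF r(1,3,1,2)]
        quadruple_product'(2)[OF r(1,3,2,1)]
        flip: scale_left_diff_distrib scale_left_distrib)
      (simp add: algebra_simps)
  have ex: "rep (scale a1 x1 + scale a2 x2 + scale a3 x3) a1 a2 a3" for a1 a2 a3
    by (simp add: rep_def)
  show ?thesis
  proof
    assume malcev_identity
    then show "\<forall>a1 a2 a3 b1 b2 b3 d1 d2 d3. ?P a1 a2 a3 b1 b2 b3 d1 d2 d3"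
      unfolding malcev_identity_def by (intro allI *[OF ex ex ex, THEN iffD1]) blast
  next
    assume P: "\<forall>a1 a2 a3 b1 b2 b3 d1 d2 d3. ?P a1 a2 a3 b1 b2 b3 d1 d2 d3"
    show malcev_identity
      unfolding malcev_identity_def
    proof (intro allI)
      fix a b d
      obtain a1 a2 a3 where a: "rep a a1 a2 a3" by (rule rep_exists)
      obtain b1 b2 b3 where b: "rep b b1 b2 b3" by (rule rep_exists)
      obtain d1 d2 d3 where d: "rep d d1 d2 d3" by (rule rep_exists)
      show "jacobian a b (a \<star> d) = jacobian a b d \<star> a"
        by (rule *[OF a b d, THEN iffD2]) (rule P[rule_format])
    qed
  qed
qed

text \<open>The condition says that l and n vanish on \<open>x3\<close>, the radical of omega, and
  are proportional. It is read off by inserting generators for all arguments.\<close>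

lemma cd_iff_coefficients: "cd_identity \<longleftrightarrow> l3 = 0 \<and> n3 = 0 \<and> l1 * n2 = l2 * n1"
proof
  assume cd_identity
  note cd = cd_iff[THEN iffD1, OF this, rule_format]
  \<comment> \<open>Arguments are listed by first occurrence:
    \<open>d1 e2 d2 e1 a1 a2 a3 b1 b2 b3 e3 d3\<close>. The first instance is d = x1, e = x3, a =
    x2, b = x3.\<close>
  have "l3 * n3 = 0" "l1 * n3 = 0" "l2 * n3 = 0"
    using cd[of 1 0 0 0 0 1 0 0 0 1 1 0] cd[of 1 0 0 0 1 0 0 0 1 0 1 0] cd[of 0 0 1 0 1 0 0 0 1 0 1 0]
    by simp_all
  moreover from this have "2 * (l3 * n1) = 0" "2 * (l3 * n2) = 0"
    using cd[of 1 1 0 0 1 0 0 0 0 1 0 0] cd[of 1 1 0 0 0 1 0 0 0 1 0 0]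
    by (auto simp: algebra_simps)
  moreover have "2 * (l1 * n2 - l2 * n1) = 0"
    using cd[of 1 1 0 0 1 0 0 0 1 0 0 0] by (simp add: algebra_simps)
  ultimately show "l3 = 0 \<and> n3 = 0 \<and> l1 * n2 = l2 * n1"
    using l_nonzero n_nonzero[OF uc] two_nonzero by auto
next
  assume "l3 = 0 \<and> n3 = 0 \<and> l1 * n2 = l2 * n1"
  then show cd_identity
    unfolding cd_iff by (elim conjE, intro allI, hypsubst_thin) algebra
qed

lemma malcev_iff_coefficients: "malcev_identity \<longleftrightarrow> l3 = 0 \<and> n3 = 0 \<and> l1 * n2 = l2 * n1"
proof
  assume malcev_identity
  note m = malcev_iff[THEN iffD1, OF this, rule_format]
  \<comment> \<open>Arguments are listed by first occurrence:
    \<open>a1 d2 a2 d1 a3 b1 b2 b3 d3\<close>. The later instances with a = x1 + x3 and a = x2 + x3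
    polarise the quadratic dependence on a.\<close>
  have "l3 * n3 = 0" "l1 * n3 = 0" "l2 * n3 = 0"
    using m[of 0 1 0 0 1 1 0 0 0] m[of 1 1 0 0 0 0 0 1 0] m[of 0 0 1 1 0 0 0 1 0]
    by simp_all
  moreover have 1: "l1 * n2 = l2 * n1"
    using m[of 1 1 0 0 0 0 1 0 0] by simp
  moreover from calculation have "l3 * n2 = 0" "l3 * n1 = 0"
    using m[of 1 1 0 0 1 0 1 0 0] m[of 0 0 1 1 1 1 0 0 0]
    by (simp_all add: algebra_simps)
  ultimately show "l3 = 0 \<and> n3 = 0 \<and> l1 * n2 = l2 * n1"
    using l_nonzero n_nonzero[OF uc] by auto
next
  assume "l3 = 0 \<and> n3 = 0 \<and> l1 * n2 = l2 * n1"
  then show malcev_identity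
    unfolding malcev_iff by (elim conjE, intro allI, hypsubst_thin) algebra
qed

end

text \<open>Applying the commutator for \<open>c\<close> and \<open>x\<close> to [x1,x2] leaves
  [[c,x],c] = 0. For \<open>x\<close> a generator this is a multiple l of [u,c], so all l would
  vanish if [u,c] did not.\<close>

lemma cd_imp_uc:
  assumes cd_identity
  shows "u \<star> c = 0"
proof (rule ccontr)
  assume uc: "u \<star> c \<noteq> 0"
  have "l = 0" if x: "c \<star> x - scale l u \<in> lcs 3" for x l
  proof -
    have 1: "(x1 \<star> c) \<star> x \<in> lcs 3" "(x2 \<star> c) \<star> x \<in> lcs 3" "(x1 \<star> x) \<star> c \<in> lcs 3" "(x2 \<star> x) \<star> c \<in> lcs 3"
      using lcs_1_mul_lcs_1[OF lcs_mem(1) c_mem] lcs_mem(4)[OF lcs_mem(3)[OF c_mem]] by blast+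
    have "(c \<star> x) \<star> c = 0"
      using assms[unfolded cd_identity_def, rule_format, of c x x1 x2] 1
      by (simp add: commutator_op_def x12 mul_self diff_mul mul_diff)
    then have "scale l (u \<star> c) = 0"
      using lcs_3_mul(1)[OF x, of c] by (simp add: diff_mul scale_mul)
    then show ?thesis
      using uc by simp
  qed
  then show False
    using cx l_nonzero by blast
qed

text \<open>If [c,u] were nonzero, polarised instances would give [c,[c,x]] = 0 for each generator
  \<open>x\<close>, contradicting \<open>l_nonzero\<close>.\<close>

lemma malcev_imp_uc:
  assumes malcev_identity
  shows "u \<star> c = 0"
proof (rule ccontr)
  assume "u \<star> c \<noteq> 0"
  then have cu: "c \<star> u \<noteq> 0"
    using mul_anticommute[of u c] by simp
  note polar = malcev_polar[OF assms]
  have rep: "jacobian a b b = 0" "jacobian a b a = 0" for a b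
    using mul_anticommute[of b a] by (simp_all add: jacobian_def mul_self minus_mul)
  have J2: "jacobian a b w = (a \<star> b) \<star> w" if "w \<in> lcs 2" for a b w
    using that by (simp add: jacobian_def lcs_mem)
  have c2: "c \<star> x \<in> lcs 2" for x
    using c_mem by (rule lcs_mem)
  have cc: "c \<star> (c \<star> x) = scale l (c \<star> u)" if "c \<star> x - scale l u \<in> lcs 3" for x l
    using lcs_3_mul(2)[OF that, of c] by (simp add: bilinear_simps)
  \<comment> \<open>All Jacobians in this instance have a repeated argument except the one that
    reduces to [c,[c,x2]].\<close>
  have "c \<star> (c \<star> x2) = 0"
    using polar[of x1 x2 c x2] by (simp add: rep x12 J2[OF c2])
  then have l2: "l2 = 0"
    using cc[OF cx(2)] cu by simp
  have "c \<star> (c \<star> x1) = 0"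
    using polar[of x2 x1 c x1] mul_anticommute[of x2 x1] mul_anticommute[of x1 c]
    by (simp add: rep J2[OF c2] x12) (simp add: minus_mul jacobian_def mul_minus mul_self)
  then have l1: "l1 = 0"
    using cc[OF cx(1)] cu by simp
  have cx2: "c \<star> x2 \<in> lcs 3"
    using cx(2) l2 by simp
  have "jacobian c x2 (x1 \<star> x3) = 0"
    using cx2 by (simp add: J2[OF x13])
  moreover have "jacobian x1 x2 x3 \<star> c = (c \<star> x3) \<star> c"
    using x23 lcs_mem(4)[OF x23, of x1] lcs_mem(4)[OF x13, of x2] mul_anticommute[of x3 x1]
    by (simp add: jacobian_def x12 add_mul diff_mul minus_mul)
  moreover have "jacobian c x2 x3 \<star> x1 = 0"
    using cx2 lcs_mem(4)[OF x23, of c] lcs_mem(4)[OF lcs_mem(3)[OF c_mem, of x3], of x2]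
    by (simp add: jacobian_def add_mul)
  \<comment> \<open>For \<open>x3\<close> the instance only gives a vector equal to its negative;
    characteristic not 2 finishes.\<close>
  ultimately have "c \<star> (c \<star> x3) = - (c \<star> (c \<star> x3))"
    using polar[of x1 x2 c x3] mul_anticommute[of "c \<star> x3" c] by (simp add: J2[OF c2] x12)
  then have "scale l3 (c \<star> u) + scale l3 (c \<star> u) = 0"
    unfolding cc[OF cx(3)] by (simp only: eq_neg_iff_add_eq_0)
  then have "l3 + l3 = 0"
    using cu by (simp flip: scale_left_distrib)
  then have "2 * l3 = 0"
    by (simp only: mult_2)
  then show False
    using l1 l2 l_nonzero two_nonzero by simp
qed

lemma cd_iff_malcev: "cd_identity \<longleftrightarrow> malcev_identity"
  using cd_imp_uc malcev_imp_uc cd_iff_coefficients malcev_iff_coefficients by blast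

end

section \<open>Dimension six\<close>

locale six_dim_nilpotent_algebra =
  anticommutative_algebra scale mul + finite_dimensional_vector_space scale Basis
  for scale :: "'a::field \<Rightarrow> 'b::ab_group_add \<Rightarrow> 'b" and mul (infixl "\<star>" 70) and Basis +
  assumes dim_6: "dim (UNIV :: 'b set) = 6" and is_nilpotent: nilpotent and two_nonzero: "(2::'a) \<noteq> 0"
begin

section \<open>Dimensions along the lower central series\<close>

declare dim_eq_0 [simp del]

lemma dim_lcs_less: "lcs n \<noteq> {0} \<Longrightarrow> dim (lcs (Suc n)) < dim (lcs n)"
  using lcs_strict[OF is_nilpotent, of n] lcs_Suc_subset[of n] subspace_dim_equal[of "lcs (Suc n)" "lcs n"]
  by (meson not_le subspace_lcs)

lemma dim_lcs_zero: "dim (lcs n) = 0 \<longleftrightarrow> lcs n = {0}"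
  using zero_mem_lcs[of n] by (auto simp: dim_eq_0)

text \<open>Truncated subtraction makes the bound valid for the zero term too.\<close>

lemma dim_lcs_Suc_le: "dim (lcs (Suc n)) \<le> dim (lcs n) - 1"
  using dim_lcs_less[of n] lcs_Suc_subset[of n] dim_lcs_zero dim_subset[OF lcs_Suc_subset, of n] by fastforce

text \<open>A basis of \<open>V\<close> is extended to one of \<open>W\<close>; \<open>S\<close>
  consists of the added vectors.\<close>

lemma complement_exists:
  assumes "subspace V" "V \<subseteq> W" "subspace W"
  obtains S where "finite S" "card S = dim W - dim V" "S \<subseteq> W" "span (S \<union> V) = W"
proof -
  obtain B where B: "B \<subseteq> V" "independent B" "V \<subseteq> span B" "card B = dim V"
    using basis_exists by blast
  obtain B' where B': "B \<subseteq> B'" "B' \<subseteq> W" "independent B'" "W \<subseteq> span B'"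
    using maximal_independent_subset_extend[of B W] B assms(2) by blast
  have fin: "finite B'" "finite B"
    using B(2) B'(3) finiteI_independent by blast+
  have "card B' = dim W"
    using B' by (intro basis_card_eq_dim)
  then have "card (B' - B) = dim W - dim V"
    using B(4) B'(1) fin by (simp add: card_Diff_subset)
  moreover have "span ((B' - B) \<union> V) = W"
  proof
    show "span ((B' - B) \<union> V) \<subseteq> W"
      using B'(2) assms by (intro span_minimal) auto
    have "span B' \<subseteq> span ((B' - B) \<union> V)"
      using B(1) by (intro span_mono) blast
    then show "W \<subseteq> span ((B' - B) \<union> V)"
      using B'(4) by blast
  qed
  ultimately show ?thesis
    using that[of "B' - B"] fin(1) B'(2) by blast
qed

lemma span_insert_eq:
  assumes "subspace V" "subspace W" "V \<subseteq> W" "a \<in> W" "a \<notin> V" "dim W \<le> Suc (dim V)"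
  shows "span (insert a V) = W"
proof (rule subspace_dim_equal[OF subspace_span assms(2)])
  show "span (insert a V) \<subseteq> W"
    using assms by (intro span_minimal) auto
  have "span V = V"
    by (simp only: span_eq_iff assms(1))
  then have "a \<notin> span V"
    using assms(5) by blast
  then show "dim W \<le> dim (span (insert a V))"
    using assms(5,6) by (simp add: dim_insert)
qed

section \<open>Coordinates and isomorphisms with algebras on \<open>'a ^ 6\<close>\<close>

definition comb :: "'b \<Rightarrow> 'b \<Rightarrow> 'b \<Rightarrow> 'b \<Rightarrow> 'b \<Rightarrow> 'b \<Rightarrow> 'a ^ 6 \<Rightarrow> 'b"
  where "comb e1 e2 e3 e4 e5 e6 v = scale (v $ 1) e1 + scale (v $ 2) e2 + scale (v $ 3) e3
    + scale (v $ 4) e4 + scale (v $ 5) e5 + scale (v $ 6) e6"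

lemma linear_comb: "Vector_Spaces.linear (*s) scale (comb e1 e2 e3 e4 e5 e6)"
  using vector_space_axioms vec.vector_space_axioms
  by (simp add: Vector_Spaces.linear_iff comb_def scale_left_distrib scale_right_distrib algebra_simps)

lemma bij_comb:
  assumes "span {e1, e2, e3, e4, e5, e6} = UNIV"
  shows "bij (comb e1 e2 e3 e4 e5 e6)"
proof -
  let ?g = "comb e1 e2 e3 e4 e5 e6"
  interpret lin: Vector_Spaces.linear "(*s)" scale ?g
    by (rule linear_comb)
  have sub: "subspace (range ?g)"
    by (rule lin.subspace_image[OF vec.subspace_UNIV])
  have "?g (axis 1 1) = e1" "?g (axis 2 1) = e2" "?g (axis 3 1) = e3"
    "?g (axis 4 1) = e4" "?g (axis 5 1) = e5" "?g (axis 6 1) = e6"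
    by (simp_all add: comb_def axis_def)
  then have "{e1, e2, e3, e4, e5, e6} \<subseteq> range ?g"
    by (metis (no_types, lifting) empty_subsetI insert_subset rangeI)
  then have surj: "surj ?g"
    using span_minimal[OF _ sub] assms by blast
  interpret pair: finite_dimensional_vector_space_pair "(*s)" "cart_basis :: ('a ^ 6) set" scale Basis
    by unfold_locales
  have "inj ?g"
    by (rule pair.linear_surjective_imp_injective[OF linear_comb surj])
      (simp only: dim_6 vec_dim_card, simp)
  with surj show ?thesis
    by (simp add: bij_def)
qed

text \<open>Maps out of the coordinate space are easier to write down; the required isomorphism is
  the inverse.\<close>

lemma algebra_isomorphicI:
  assumes "Vector_Spaces.linear (*s) scale g" "bij g" "\<And>v w :: 'a ^ 6. g (m v w) = g v \<star> g w"
  shows "algebra_isomorphic scale (\<star>) (*s) m"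
proof -
  define f where "f = inv g"
  have gf: "g (f x) = x" for x
    using assms(2) by (simp add: f_def bij_inv_eq_iff surj_f_inv_f bij_is_surj)
  have inj: "g v = g w \<Longrightarrow> v = w" for v w
    using assms(2) by (auto simp: bij_def inj_def)
  have g: "g (v + w) = g v + g w" "g (k *s v) = scale k (g v)" for v w k
    using assms(1) by (simp_all add: Vector_Spaces.linear_iff)
  have "Vector_Spaces.linear scale (*s) f"
    using vector_space_axioms vec.vector_space_axioms
    by (auto simp: Vector_Spaces.linear_iff g gf intro!: inj)
  moreover have "bij f"
    unfolding f_def by (rule bij_imp_bij_inv[OF assms(2)])
  moreover have "f (x \<star> y) = m (f x) (f y)" for x y
    by (rule inj) (simp add: gf assms(3))
  ultimately show ?thesis
    unfolding algebra_isomorphic_def by blast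
qed

lemma B61_isomorphicI:
  assumes "span {e1, e2, e3, e4, e5, e6} = UNIV"
    and table: "e1 \<star> e2 = e4" "e1 \<star> e3 = e5" "e2 \<star> e3 = scale \<alpha> e6" "e4 \<star> e5 = e6"
      "e1 \<star> e4 = 0" "e1 \<star> e5 = 0" "e2 \<star> e4 = 0" "e2 \<star> e5 = 0" "e3 \<star> e4 = 0" "e3 \<star> e5 = 0"
    and e6: "\<And>v. e6 \<star> v = 0"
  shows "algebra_isomorphic scale (\<star>) (*s) (B61 \<alpha>)"
proof (rule algebra_isomorphicI[OF linear_comb bij_comb[OF assms(1)]])
  fix v w :: "'a ^ 6"
  have flip: "e2 \<star> e1 = - e4" "e3 \<star> e1 = - e5" "e3 \<star> e2 = - scale \<alpha> e6" "e5 \<star> e4 = - e6"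
    "e4 \<star> e1 = 0" "e5 \<star> e1 = 0" "e4 \<star> e2 = 0" "e5 \<star> e2 = 0" "e4 \<star> e3 = 0" "e5 \<star> e3 = 0"
    using mul_anticommute[of e2 e1] mul_anticommute[of e3 e1] mul_anticommute[of e3 e2]
      mul_anticommute[of e5 e4] mul_anticommute[of e4 e1] mul_anticommute[of e5 e1]
      mul_anticommute[of e4 e2] mul_anticommute[of e5 e2] mul_anticommute[of e4 e3]
      mul_anticommute[of e5 e3] table by simp_all
  have e6': "x \<star> e6 = 0" for x
    using e6[of x] mul_anticommute[of x e6] by simp
  have "comb e1 e2 e3 e4 e5 e6 v \<star> comb e1 e2 e3 e4 e5 e6 w =
      scale (v $ 1 * w $ 2 - v $ 2 * w $ 1) e4 + scale (v $ 1 * w $ 3 - v $ 3 * w $ 1) e5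
      + scale (\<alpha> * (v $ 2 * w $ 3 - v $ 3 * w $ 2) + (v $ 4 * w $ 5 - v $ 5 * w $ 4)) e6"
    by (simp add: comb_def bilinear_simps table flip e6 e6' mul_self scale_left_distrib
        scale_left_diff_distrib scale_right_distrib scale_right_diff_distrib algebra_simps)
  moreover have "B61 \<alpha> v w $ i = (if i = 4 then v $ 1 * w $ 2 - v $ 2 * w $ 1
      else if i = 5 then v $ 1 * w $ 3 - v $ 3 * w $ 1
      else if i = 6 then \<alpha> * (v $ 2 * w $ 3 - v $ 3 * w $ 2) + (v $ 4 * w $ 5 - v $ 5 * w $ 4)
      else 0)" for i
    by (simp add: B61_def axis_def)
  ultimately show "comb e1 e2 e3 e4 e5 e6 (B61 \<alpha> v w) =
      comb e1 e2 e3 e4 e5 e6 v \<star> comb e1 e2 e3 e4 e5 e6 w"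
    by (simp add: comb_def)
qed

text \<open>The product is transported to \<open>'a ^ 6\<close> along a linear isomorphism, which
  exists by equality of dimensions.\<close>

lemma malcev_isomorphic:
  assumes malcev_identity
  shows "\<exists>m :: 'a ^ 6 \<Rightarrow> 'a ^ 6 \<Rightarrow> 'a ^ 6. malcev_algebra (*s) m \<and> algebra_isomorphic scale (\<star>) (*s) m"
proof -
  interpret pair: finite_dimensional_vector_space_pair "(*s)" "cart_basis :: ('a ^ 6) set" scale Basis
    by unfold_locales
  have "vec.dim (UNIV :: ('a ^ 6) set) = dim UNIV"
    by (simp only: dim_6 vec_dim_card) simp
  then obtain g :: "'a ^ 6 \<Rightarrow> 'b" where lin: "Vector_Spaces.linear (*s) scale g" and "range g = UNIV" "inj g"
    using pair.subspace_isomorphism[of UNIV UNIV] by auto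
  then have bij: "bij g"
    by (simp add: bij_def)
  then obtain f where fg: "\<And>v. f (g v) = v" and gf: "\<And>x. g (f x) = x"
    by (metis bij_inv_eq_iff)
  have g: "g (v + w) = g v + g w" "g (k *s v) = scale k (g v)" for v w k
    using lin by (simp_all add: Vector_Spaces.linear_iff)
  have f: "f (x + y) = f x + f y" "f (scale k x) = k *s f x" for x y k
    by (metis fg gf g)+
  define m where "m v w = f (g v \<star> g w)" for v w
  have f0: "f 0 = 0"
    using f(2)[of 0 0] by simp
  interpret m: anticommutative_algebra "(*s)" m
    by unfold_locales (simp_all add: m_def f g bilinear_simps mul_self f0)
  have "m.jacobian u v w = f (jacobian (g u) (g v) (g w))" for u v w
    by (simp add: m.jacobian_def jacobian_def m_def gf f)
  then have "malcev_algebra (*s) m"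
    using assms by unfold_locales (simp add: m_def gf malcev_identity_def)
  moreover have "algebra_isomorphic scale (\<star>) (*s) m"
    by (rule algebra_isomorphicI[OF lin bij]) (simp add: m_def gf)
  ultimately show ?thesis
    by blast
qed


section \<open>The cases according to the dimension of C_2\<close>

lemma central_imp_degree_four_zero:
  assumes "lcs 3 = {0}" "lcs 1 \<subseteq> span (T \<union> lcs 2)" "\<And>s t. s \<in> T \<Longrightarrow> t \<in> T \<Longrightarrow> s \<star> t = 0"
  shows "cd_identity \<and> malcev_identity"
proof -
  have c: "r \<star> v = 0" "v \<star> r = 0" if "r \<in> lcs 2" for r v
    using lcs_mul[OF that, of v] mul_lcs[OF that, of v] assms(1) by (auto simp: eval_nat_numeral)
  have t: "t \<star> v = 0" if "t \<in> T" "v \<in> lcs 1" for t v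
    by (rule mul_span_zero(1)[where T = "T \<union> lcs 2"]) (use assms c that in auto)
  have "u \<star> v = 0" if "u \<in> lcs 1" "v \<in> lcs 1" for u v
    by (rule mul_span_zero(2)[where T = "T \<union> lcs 2"]) (use assms(2) t c that in auto)
  then show ?thesis
    using degree_four_zero[OF assms(1)] by blast
qed

text \<open>With at most one generator x modulo C_2, [x,x] = 0 gives C_2 = C_3, hence C_2 = 0 by
  nilpotency.\<close>

lemma dim_lcs_1_le: "dim (lcs 1) \<le> 4"
proof (rule ccontr)
  assume not: "\<not> dim (lcs 1) \<le> 4"
  obtain S where S: "finite S" "card S = 6 - dim (lcs 1)" "span (S \<union> lcs 1) = UNIV"
    using complement_exists[OF subspace_lcs, of 1 UNIV] dim_6 by auto
  then have "card S \<le> Suc 0"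
    using not by simp
  then have "s = t" if "s \<in> S" "t \<in> S" for s t
    using S(1) that card_le_Suc0_iff_eq by blast
  then have "s \<star> t = 0" if "s \<in> S" "t \<in> S" for s t
    using mul_self that by metis
  then have "lcs 1 \<subseteq> lcs 2"
    by (intro lcs_1_minimal[OF S(3)]) simp_all
  then have "lcs 1 = {0}"
    using lcs_strict[OF is_nilpotent, of 1] lcs_Suc_subset[of 1] by (auto simp: numeral_2_eq_2)
  then have "dim (lcs 1) = 0"
    using dim_lcs_zero[of 1] by blast
  then show False
    using not by simp
qed

lemma two_generated_case:
  assumes "dim (lcs 1) = 4"
  shows "cd_identity \<longleftrightarrow> malcev_identity"
proof -
  obtain S where S: "finite S" "card S = 2" "span (S \<union> lcs 1) = UNIV"
    using complement_exists[OF subspace_lcs, of 1 UNIV] dim_6 assms by auto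
  then obtain x y where "S = {x, y}"
    by (auto simp: card_2_iff)
  moreover have "dim (lcs 5) = 0"
    using dim_lcs_Suc_le[of 1] dim_lcs_Suc_le[of 2] dim_lcs_Suc_le[of 3] dim_lcs_Suc_le[of 4] assms
    by (simp add: eval_nat_numeral)
  moreover have "v = 0" if "scale 2 v = 0" for v
    using that two_nonzero by simp
  ultimately interpret two_generated_algebra scale mul x y
    using S(3) by unfold_locales (simp_all add: dim_lcs_zero)
  show ?thesis
    using cd_imp_lie malcev_imp_lie lie_imp_cd_identity lie_imp_malcev_identity by blast
qed

text \<open>The dimensions force C_4 = 0. Either C_3 = 0 and C_2 annihilates A, or C_2 modulo C_3 is
  spanned by at most one vector, whose square is zero.\<close>

lemma small_square_case:
  assumes "dim (lcs 1) \<le> 2"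
  shows "cd_identity \<and> malcev_identity"
proof -
  have "dim (lcs 3) = 0" and 2: "dim (lcs 2) \<le> dim (lcs 1) - 1"
    using dim_lcs_Suc_le[of 1] dim_lcs_Suc_le[of 2] assms by (simp_all add: eval_nat_numeral)
  then have 3: "lcs 3 = {0}"
    by (simp only: dim_lcs_zero)
  show ?thesis
  proof (cases "lcs 2 = {0}")
    case True
    then have "u \<star> v = 0" if "u \<in> lcs 1" for u v
      using lcs_mul[OF that, of v] by (auto simp: numeral_2_eq_2)
    then show ?thesis
      using degree_four_zero[OF 3] by blast
  next
    case False
    then have "dim (lcs 2) \<noteq> 0"
      using dim_lcs_zero[of 2] by blast
    moreover obtain S where S: "finite S" "card S = dim (lcs 1) - dim (lcs 2)" "span (S \<union> lcs 2) = lcs 1"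
      by (rule complement_exists[of "lcs 2" "lcs 1"]) (simp_all add: lcs_antimono)
    ultimately have "card S \<le> Suc 0"
      using assms by linarith
    then have "s = t" if "s \<in> S" "t \<in> S" for s t
      using S(1) that card_le_Suc0_iff_eq by blast
    then have "s \<star> t = 0" if "s \<in> S" "t \<in> S" for s t
      using mul_self that by metis
    then show ?thesis
      using central_imp_degree_four_zero[OF 3, of S] S(3) by blast
  qed
qed

lemma three_generators:
  assumes "dim (lcs 1) = 3"
  obtains x1 x2 x3 where "span ({x1, x2, x3} \<union> lcs 1) = UNIV"
proof -
  obtain S where S: "finite S" "card S = 3" "span (S \<union> lcs 1) = UNIV"
    using complement_exists[OF subspace_lcs, of 1 UNIV] dim_6 assms by auto
  then show ?thesis
    using that by (auto simp: card_3_iff)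
qed

lemma class_four_case:
  assumes dim_1: "dim (lcs 1) = 3" and lcs_3: "lcs 3 \<noteq> {0}"
  shows "cd_identity \<longleftrightarrow> malcev_identity"
proof -
  have "dim (lcs 3) \<noteq> 0"
    using lcs_3 dim_lcs_zero[of 3] by blast
  moreover have "dim (lcs 2) \<le> dim (lcs 1) - 1" "dim (lcs 3) \<le> dim (lcs 2) - 1" "dim (lcs 4) \<le> dim (lcs 3) - 1"
    using dim_lcs_Suc_le[of 1] dim_lcs_Suc_le[of 2] dim_lcs_Suc_le[of 3] by (simp_all add: eval_nat_numeral)
  ultimately have dims: "dim (lcs 2) = 2" "dim (lcs 3) = 1" "dim (lcs 4) = 0"
    using dim_1 by linarith+
  then have lcs_4: "lcs 4 = {0}"
    by (simp only: dim_lcs_zero)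
  have sub: "lcs 2 \<subseteq> lcs 1" "lcs 3 \<subseteq> lcs 2"
    by (simp_all add: lcs_antimono)
  obtain y1 y2 y3 where y: "span ({y1, y2, y3} \<union> lcs 1) = UNIV"
    using three_generators[OF dim_1] .
  have "\<not> lcs 1 \<subseteq> lcs 2"
    using dims dim_1 dim_subset[of "lcs 1" "lcs 2"] by auto
  then obtain s t where "s \<in> {y1, y2, y3}" "t \<in> {y1, y2, y3}" "s \<star> t \<notin> lcs 2"
    using lcs_1_minimal[OF y, of "lcs 2"] by auto
  moreover have "s \<noteq> t"
    using calculation(3) mul_self by auto
  ultimately obtain x1 x2 x where "{x1, x2, x} = {y1, y2, y3}" and x12: "x1 \<star> x2 \<notin> lcs 2"
    by (smt (verit) insert_commute insertE singletonD)
  then have x: "span ({x1, x2, x} \<union> lcs 1) = UNIV"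
    using y by simp
  define c where "c = x1 \<star> x2"
  have c1: "c \<in> lcs 1"
    by (simp add: c_def lcs_mem del: One_nat_def)
  have span_1: "span (insert c (lcs 2)) = lcs 1"
    using c1 x12 dims dim_1 sub by (intro span_insert_eq) (auto simp: c_def)
  have span_lcs: "span (lcs n) = lcs n" for n
    by (simp only: span_eq_iff subspace_lcs)
  have mod_2: "\<exists>k. v - scale k c \<in> lcs 2" if "v \<in> lcs 1" for v
    using that unfolding span_1[symmetric] span_breakdown_eq span_lcs .
  obtain k2 k1 where k: "x1 \<star> x - scale k2 c \<in> lcs 2" "x2 \<star> x - scale k1 c \<in> lcs 2"
    using mod_2 lcs_mem(1) by meson
  \<comment> \<open>The corrections cancel the \<open>c\<close>-components of [x1,x] and [x2,x], so
    \<open>x3\<close> represents the radical of the alternating form.\<close>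
  define x3 where "x3 = x - scale k2 x2 + scale k1 x1"
  have x13: "x1 \<star> x3 \<in> lcs 2" and x23: "x2 \<star> x3 \<in> lcs 2"
    using k mul_anticommute[of x2 x1] by (simp_all add: x3_def bilinear_simps mul_self c_def)
  have gen: "span ({x1, x2, x3} \<union> lcs 1) = UNIV"
  proof -
    let ?V = "span ({x1, x2, x3} \<union> lcs 1)"
    have "x1 \<in> ?V" "x2 \<in> ?V" "x3 \<in> ?V" "lcs 1 \<subseteq> ?V"
      by (auto intro: span_base)
    moreover from this have "x3 + scale k2 x2 - scale k1 x1 \<in> ?V"
      by (intro span_add span_diff span_scale)
    then have "x \<in> ?V"
      by (simp add: x3_def)
    ultimately have "span ({x1, x2, x} \<union> lcs 1) \<subseteq> ?V"
      by (intro span_minimal) auto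
    then show ?thesis
      using x by blast
  qed
  have "\<not> lcs 2 \<subseteq> lcs 3"
    using dims dim_subset[of "lcs 2" "lcs 3"] by auto
  then obtain u where u: "u \<in> lcs 2" "u \<notin> lcs 3"
    by blast
  have span_2: "span (insert u (lcs 3)) = lcs 2"
    using u dims sub by (intro span_insert_eq) auto
  have mod_3: "\<exists>k. v - scale k u \<in> lcs 3" if "v \<in> lcs 2" for v
    using that unfolding span_2[symmetric] span_breakdown_eq span_lcs .
  obtain l1 l2 l3 where l: "c \<star> x1 - scale l1 u \<in> lcs 3" "c \<star> x2 - scale l2 u \<in> lcs 3"
      "c \<star> x3 - scale l3 u \<in> lcs 3"
    using mod_3 lcs_mem(2)[OF c1] by meson
  obtain z where z: "z \<in> lcs 3" "z \<noteq> 0"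
    using lcs_3 zero_mem_lcs[of 3] by blast
  have span_3: "span (insert z {0}) = lcs 3"
    using z dims by (intro span_insert_eq) auto
  have mod_4: "\<exists>k. v = scale k z" if "v \<in> lcs 3" for v
    using that unfolding span_3[symmetric] span_breakdown_eq by simp
  obtain n1 n2 n3 where n: "u \<star> x1 = scale n1 z" "u \<star> x2 = scale n2 z" "u \<star> x3 = scale n3 z"
    using mod_4 lcs_mem(4)[OF u(1)] by meson
  have c_lcs_1: "c \<star> v \<in> lcs 3" if "v \<in> lcs 1" for v
    by (rule mul_span_mem(1)[where T = "insert c (lcs 2)"]) (use that span_1 lcs_mem(5) mul_self in auto)
  \<comment> \<open>If all three vanished, \<open>c\<close> would multiply A into C_4 and C_3 would
    collapse to C_4.\<close>
  have "l1 \<noteq> 0 \<or> l2 \<noteq> 0 \<or> l3 \<noteq> 0"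
  proof (rule ccontr)
    assume "\<not> ?thesis"
    with l have x: "c \<star> x1 \<in> lcs 3" "c \<star> x2 \<in> lcs 3" "c \<star> x3 \<in> lcs 3"
      by simp_all
    have cv: "c \<star> v \<in> lcs 3" for v
      by (rule mul_span_mem(1)[where T = "{x1, x2, x3} \<union> lcs 1"]) (use gen x c_lcs_1 in auto)
    have "lcs (Suc 1) \<subseteq> lcs 3"
    proof (rule lcs_Suc_minimal[where T = "{c}"])
      show "lcs 1 \<subseteq> span ({c} \<union> lcs (Suc 1))"
        using span_1 by (simp add: numeral_2_eq_2)
      show "lcs (Suc (Suc 1)) \<subseteq> lcs 3"
        by (simp add: numeral_3_eq_3)
    qed (use cv in auto)
    then show False
      using u by (auto simp: numeral_2_eq_2)
  qed
  \<comment> \<open>If all three vanished along with [u,c], \<open>u\<close> would annihilate A and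
    C_4 would be zero.\<close>
  moreover have "n1 \<noteq> 0 \<or> n2 \<noteq> 0 \<or> n3 \<noteq> 0" if uc: "u \<star> c = 0"
  proof (rule ccontr)
    assume "\<not> ?thesis"
    with n have x: "u \<star> x1 = 0" "u \<star> x2 = 0" "u \<star> x3 = 0"
      by simp_all
    have u3: "u \<star> v = 0" if "v \<in> lcs 3" for v
      using mul_lcs[OF that, of u] lcs_4 by (auto simp: eval_nat_numeral)
    have u2: "u \<star> v = 0" if "v \<in> lcs 2" for v
      by (rule mul_span_zero(1)[where T = "insert u (lcs 3)"]) (use that span_2 mul_self u3 in auto)
    have u1: "u \<star> v = 0" if "v \<in> lcs 1" for v
      by (rule mul_span_zero(1)[where T = "insert c (lcs 2)"]) (use that span_1 uc u2 in auto)
    have uv: "u \<star> v = 0" for v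
      by (rule mul_span_zero(1)[where T = "{x1, x2, x3} \<union> lcs 1"]) (use gen x u1 in auto)
    have "lcs (Suc 2) \<subseteq> {0}"
    proof (rule lcs_Suc_minimal[where T = "{u}"])
      show "lcs 2 \<subseteq> span ({u} \<union> lcs (Suc 2))"
        using span_2 by (simp add: numeral_3_eq_3 numeral_2_eq_2)
      show "lcs (Suc (Suc 2)) \<subseteq> {0}"
        using lcs_4 by (simp add: eval_nat_numeral)
    qed (use uv in auto)
    then show False
      using z by (auto simp: numeral_3_eq_3 numeral_2_eq_2)
  qed
  ultimately interpret class_four_algebra scale mul x1 x2 x3 c u z l1 l2 l3 n1 n2 n3
    using gen lcs_4 x13 x23 span_1 span_2 u l n z two_nonzero
    by unfold_locales (simp_all add: c_def)
  show ?thesis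
    by (rule cd_iff_malcev)
qed

text \<open>Failure of an identity makes some bracket of two products [yi,yj] nonzero. Two different
  index pairs from three indices share an index, and the shared one is renumbered first.\<close>

lemma class_three_generators:
  assumes dim_1: "dim (lcs 1) = 3" and lcs_3: "lcs 3 = {0}" and "\<not> (cd_identity \<and> malcev_identity)"
  obtains x1 x2 x3 where "span ({x1, x2, x3} \<union> lcs 1) = UNIV" "(x1 \<star> x2) \<star> (x1 \<star> x3) \<noteq> 0"
proof -
  obtain y1 y2 y3 where y: "span ({y1, y2, y3} \<union> lcs 1) = UNIV"
    using three_generators[OF dim_1] .
  let ?T = "{y1 \<star> y2, y1 \<star> y3, y2 \<star> y3}"
  have "lcs 1 \<subseteq> span (?T \<union> lcs 2)"
  proof (rule lcs_1_minimal[OF y subspace_span])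
    show "lcs 2 \<subseteq> span (?T \<union> lcs 2)"
      by (auto intro: span_base)
    have T: "t \<in> span (?T \<union> lcs 2)" "- t \<in> span (?T \<union> lcs 2)" if "t \<in> ?T" for t
      using that by (auto intro!: span_neg intro: span_base)
    show "s \<star> t \<in> span (?T \<union> lcs 2)" if "s \<in> {y1, y2, y3}" "t \<in> {y1, y2, y3}" for s t
      using that T mul_anticommute[of y2 y1] mul_anticommute[of y3 y1] mul_anticommute[of y3 y2]
      by (elim insertE emptyE) (simp_all add: mul_self span_zero)
  qed
  then obtain s t where st: "s \<in> ?T" "t \<in> ?T" "s \<star> t \<noteq> 0"
    using central_imp_degree_four_zero[OF lcs_3] assms(3) by blast
  have "(y1 \<star> y2) \<star> (y1 \<star> y3) \<noteq> 0 \<or> (y2 \<star> y1) \<star> (y2 \<star> y3) \<noteq> 0 \<or> (y3 \<star> y1) \<star> (y3 \<star> y2) \<noteq> 0"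
  proof (rule ccontr)
    assume "\<not> ?thesis"
    then have "(y1 \<star> y2) \<star> (y1 \<star> y3) = 0" "(y1 \<star> y2) \<star> (y2 \<star> y3) = 0" "(y1 \<star> y3) \<star> (y2 \<star> y3) = 0"
      using mul_anticommute[of y2 y1] mul_anticommute[of y3 y1] mul_anticommute[of y3 y2]
      by (simp_all add: minus_mul mul_minus)
    then show False
      using st mul_anticommute[of s t] by (elim insertE emptyE) (simp_all add: mul_self)
  qed
  moreover have "{y2, y1, y3} = {y1, y2, y3}" "{y3, y1, y2} = {y1, y2, y3}"
    by auto
  ultimately show ?thesis
    using that[of y1 y2 y3] that[of y2 y1 y3] that[of y3 y1 y2] y by auto
qed

text \<open>Since C_4 = 0, the Malcev identity at these generators reduces to [[x1,x2],[x1,x3]] =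
  0.\<close>

lemma class_three_not_malcev:
  assumes "lcs 3 = {0}" "(x1 \<star> x2) \<star> (x1 \<star> x3) \<noteq> 0"
  shows "\<not> malcev_identity"
proof
  assume malcev_identity
  then have "jacobian x1 x2 (x1 \<star> x3) = jacobian x1 x2 x3 \<star> x1"
    by (simp add: malcev_identity_def)
  moreover have "(u \<star> v) \<star> w \<in> lcs 2" for u v w
    using lcs_mem(1,2) by blast
  then have "((u \<star> v) \<star> w) \<star> t = 0" "(t \<star> (u \<star> v)) \<star> w = 0" for u v w t
    using lcs_mem(4) assms(1) mul_anticommute[of t "u \<star> v"] minus_mul[of "u \<star> v \<star> t" w]
    by (metis singletonD, metis minus_zero singletonD)
  ultimately show False
    using assms(2) by (simp add: jacobian_def add_mul)
qed

text \<open>C_3 annihilates A, so [a,b] nonzero makes \<open>a\<close>, \<open>b\<close> independent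
  modulo C_3. Hence C_3 is the line through \<open>z\<close>, and the generators can be adjusted to
  the required table.\<close>

lemma class_three_case:
  assumes dim_1: "dim (lcs 1) = 3" and lcs_3: "lcs 3 = {0}"
    and gen: "span ({x1, x2, x3} \<union> lcs 1) = UNIV" and nonzero: "(x1 \<star> x2) \<star> (x1 \<star> x3) \<noteq> 0"
  shows "\<exists>\<alpha>. algebra_isomorphic scale (\<star>) (*s) (B61 \<alpha>)"
proof -
  define a where "a = x1 \<star> x2"
  define b where "b = x1 \<star> x3"
  define z where "z = a \<star> b"
  have z: "z \<noteq> 0"
    using nonzero by (simp add: a_def b_def z_def)
  have a1: "a \<in> lcs 1" and b1: "b \<in> lcs 1"
    unfolding a_def b_def by (rule lcs_mem(1))+
  have z2: "z \<in> lcs 2"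
    using a1 unfolding z_def by (rule lcs_mem(2))
  have cen: "r \<star> v = 0" "v \<star> r = 0" if "r \<in> lcs 2" for r v
    using lcs_mem(4,5)[OF that] lcs_3 by blast+
  have ba: "b \<star> a = - z"
    using mul_anticommute[of b a] by (simp add: z_def)
  have span_lcs: "span (lcs n) = lcs n" for n
    by (simp only: span_eq_iff subspace_lcs)
  have sub: "lcs 2 \<subseteq> lcs 1"
    by (simp add: lcs_antimono)
  have b2: "b \<notin> lcs 2"
    using cen(2)[of b a] z by (auto simp: z_def)
  have a2: "a \<notin> span (insert b (lcs 2))"
  proof
    assume "a \<in> span (insert b (lcs 2))"
    then have "a \<star> b = 0"
      by (rule mul_span_zero(2)) (use cen mul_self in auto)
    then show False
      using z by (simp add: z_def)
  qed
  have dim_b: "dim (span (insert b (lcs 2))) = dim (lcs 2) + 1"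
    using b2 by (simp add: dim_insert span_lcs)
  then have dim_ab: "dim (span (insert a (span (insert b (lcs 2))))) = dim (lcs 2) + 2"
    using a2 by (simp only: dim_span dim_insert span_span) simp
  have ab_sub: "span (insert a (span (insert b (lcs 2)))) \<subseteq> lcs 1"
    using a1 b1 sub by (intro span_minimal subspace_lcs) (simp add: span_minimal)
  have "dim (lcs 2) \<noteq> 0"
    using z z2 dim_lcs_zero[of 2] by auto
  moreover have "dim (lcs 2) + 2 \<le> dim (lcs 1)"
    using dim_subset[OF ab_sub] dim_ab by linarith
  ultimately have dim_2: "dim (lcs 2) = 1"
    using dim_1 by linarith
  have span_1: "span (insert a (span (insert b (lcs 2)))) = lcs 1"
    using dim_ab dim_2 dim_1 by (intro subspace_dim_equal[OF subspace_span subspace_lcs ab_sub]) linarith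
  have span_2: "span (insert z {0}) = lcs 2"
    using z z2 dim_2 by (intro span_insert_eq) auto
  have mod_2: "\<exists>k. v = scale k z" if "v \<in> lcs 2" for v
    using that unfolding span_2[symmetric] span_breakdown_eq by simp
  have "\<exists>k l. v - scale k a - scale l b \<in> lcs 2" if "v \<in> lcs 1" for v
    using that unfolding span_1[symmetric] span_breakdown_eq span_span span_lcs .
  then obtain k l where kl: "x2 \<star> x3 - scale k a - scale l b \<in> lcs 2"
    using lcs_mem(1) by meson
  \<comment> \<open>Shifting by multiples of \<open>x1\<close> keeps the brackets with
    \<open>x1\<close> and removes the \<open>a\<close>- and \<open>b\<close>-components of
    [x2,x3].\<close>
  define y2 where "y2 = x2 - scale l x1"
  define y3 where "y3 = x3 + scale k x1"
  have y: "x1 \<star> y2 = a" "x1 \<star> y3 = b"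
    by (simp_all add: y2_def y3_def bilinear_simps mul_self a_def b_def)
  have "y2 \<star> y3 = x2 \<star> x3 - scale k a - scale l b"
    using mul_anticommute[of x2 x1] by (simp add: y2_def y3_def bilinear_simps mul_self a_def b_def)
  then have y23: "y2 \<star> y3 \<in> lcs 2"
    using kl by simp
  have "\<exists>k. x \<star> a = scale k z" "\<exists>k. x \<star> b = scale k z" for x
    using mod_2 lcs_mem(3) a1 b1 by blast+
  then obtain p q where p: "\<And>x. x \<star> a = scale (p x) z" and q: "\<And>x. x \<star> b = scale (q x) z"
    by metis
  \<comment> \<open>As \<open>a \<star> b = z \<noteq> 0\<close>, adding multiples of \<open>a\<close> and \<open>b\<close> to \<open>x\<close> makes its products with both vanish.\<close>
  define f where "f x = x - scale (q x) a + scale (p x) b" for x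
  have fa: "f x \<star> a = 0" and fb: "f x \<star> b = 0" for x
    using p[of x] q[of x] unfolding f_def bilinear_simps by (simp_all add: mul_self ba flip: z_def)
  have f_mul: "f x \<star> f y = f x \<star> y" for x y
    by (simp add: f_def[of y] bilinear_simps fa fb)
  \<comment> \<open>Passing to \<open>f x\<close> and \<open>f y\<close> alters a product only by a
    multiple of the central element \<open>z\<close>, which the new e4, e5 and \<alpha>
    absorb.\<close>
  have f_mul_mod: "\<exists>k. f x \<star> f y = x \<star> y + scale k z" for x y
    using mul_anticommute[of a y] mul_anticommute[of b y] unfolding f_mul
    by (intro exI[of _ "q x * p y - p x * q y"])
      (simp add: f_def bilinear_simps p q scale_left_diff_distrib)
  obtain s where s: "f x1 \<star> f y2 = a + scale s z"
    using f_mul_mod[of x1 y2] y by auto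
  obtain t where t: "f x1 \<star> f y3 = b + scale t z"
    using f_mul_mod[of x1 y3] y by auto
  obtain \<alpha> where \<alpha>: "f y2 \<star> f y3 = scale \<alpha> z"
  proof -
    obtain k l where "f y2 \<star> f y3 = y2 \<star> y3 + scale k z" "y2 \<star> y3 = scale l z"
      using f_mul_mod[of y2 y3] mod_2[OF y23] by blast
    then show ?thesis
      using that[of "l + k"] by (simp add: scale_left_distrib)
  qed
  let ?V = "span {f x1, f y2, f y3, a + scale s z, b + scale t z, z}"
  have V: "f x1 \<in> ?V" "f y2 \<in> ?V" "f y3 \<in> ?V" "a + scale s z \<in> ?V" "b + scale t z \<in> ?V" "z \<in> ?V"
    by (auto intro: span_base)
  have aV: "a \<in> ?V" and bV: "b \<in> ?V"
    using span_diff[OF V(4) span_scale[OF V(6)], of s] span_diff[OF V(5) span_scale[OF V(6)], of t]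
    by simp_all
  have "lcs 2 \<subseteq> ?V"
    unfolding span_2[symmetric] using V(6) by (intro span_minimal) (auto simp: span_zero)
  then have lcs_1: "lcs 1 \<subseteq> ?V"
    unfolding span_1[symmetric] using aV bV by (intro span_minimal insert_subsetI) auto
  have fV: "x \<in> ?V" if "f x \<in> ?V" for x
    using span_add[OF span_diff[OF that span_scale[OF bV]] span_scale[OF aV], of "p x" "q x"]
    by (simp add: f_def)
  have x1: "x1 \<in> ?V"
    by (rule fV[OF V(1)])
  moreover have "x2 \<in> ?V"
    using span_add[OF fV[OF V(2)] span_scale[OF x1], of l] by (simp add: y2_def)
  moreover have "x3 \<in> ?V"
    using span_diff[OF fV[OF V(3)] span_scale[OF x1], of k] by (simp add: y3_def)
  ultimately have "span ({x1, x2, x3} \<union> lcs 1) \<subseteq> ?V"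
    using lcs_1 by (intro span_minimal) auto
  then have "?V = UNIV"
    using gen by blast
  then have "algebra_isomorphic scale (\<star>) (*s) (B61 \<alpha>)"
    using s t \<alpha> cen[OF z2] z_def
    by (intro B61_isomorphicI[of "f x1" "f y2" "f y3" "a + scale s z" "b + scale t z" z])
      (simp_all add: bilinear_simps fa fb)
  then show ?thesis
    by blast
qed

lemma cd_imp_malcev_or_B61:
  assumes cd_identity
  shows "malcev_identity \<or> (\<exists>\<alpha>. algebra_isomorphic scale (\<star>) (*s) (B61 \<alpha>))"
proof -
  consider "dim (lcs 1) = 4" | "dim (lcs 1) \<le> 2" | "dim (lcs 1) = 3"
    using dim_lcs_1_le by linarith
  then show ?thesis
  proof cases
    case 3
    then show ?thesis
      using class_four_case class_three_generators class_three_case assms by (cases "lcs 3 = {0}") metis+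
  qed (use assms two_generated_case small_square_case in blast)+
qed

lemma malcev_imp_cd:
  assumes malcev_identity
  shows cd_identity
proof -
  consider "dim (lcs 1) = 4" | "dim (lcs 1) \<le> 2" | "dim (lcs 1) = 3"
    using dim_lcs_1_le by linarith
  then show ?thesis
  proof cases
    case 3
    then show ?thesis
      using class_four_case class_three_generators class_three_not_malcev assms by (cases "lcs 3 = {0}") metis+
  qed (use assms two_generated_case small_square_case in blast)+
qed

end

section \<open>From the hypotheses to the locale, and the theorem\<close>

lemma six_dim_nilpotent_algebraI:
  fixes scale :: "'f::field \<Rightarrow> 'a::ab_group_add \<Rightarrow> 'a" and mul
  assumes "CHAR('f) \<noteq> 2" "anticommutative_algebra scale mul"
    "vector_space.dim scale (UNIV :: 'a set) = 6" "nonassoc_algebra.nilpotent scale mul"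
  obtains Basis where "six_dim_nilpotent_algebra scale mul Basis"
proof -
  interpret anticommutative_algebra scale mul
    by fact
  obtain B where B: "independent B" "UNIV \<subseteq> span B" "card B = 6"
    using basis_exists[of UNIV] assms(3) by auto
  have "(2::'f) \<noteq> 0"
  proof
    assume "(2::'f) = 0"
    then have "CHAR('f) dvd 2"
      using of_nat_eq_0_iff_char_dvd[where 'a = 'f and n = 2] by simp
    \<comment> \<open>The characteristic divides the prime 2 and differs from it; a field cannot
      have characteristic 1.\<close>
    then have "CHAR('f) = 1"
      using assms(1) two_is_prime_nat by (auto simp: prime_nat_iff)
    then show False
      by simp
  qed
  moreover have "finite B"
    using B(3) by (metis card.infinite zero_neq_numeral)
  ultimately have "six_dim_nilpotent_algebra scale mul B"
    using B assms(3,4) by unfold_locales auto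
  then show ?thesis
    using that by blast
qed

theorem theorem10:
  fixes scale :: "'f::field \<Rightarrow> 'a::ab_group_add \<Rightarrow> 'a"
    and mul :: "'a \<Rightarrow> 'a \<Rightarrow> 'a"
  assumes "CHAR('f) \<noteq> 2"
  shows "(anticommutative_algebra scale mul \<and> vector_space.dim scale (UNIV :: 'a set) = 6 \<and>
          nonassoc_algebra.nilpotent scale mul \<and> cd_algebra scale mul \<longrightarrow>
            (\<exists>m :: 'f ^ 6 \<Rightarrow> 'f ^ 6 \<Rightarrow> 'f ^ 6.
                malcev_algebra (*s) m \<and> algebra_isomorphic scale mul (*s) m) \<or>
            (\<exists>\<alpha>. algebra_isomorphic scale mul (*s) (B61 \<alpha>)))
       \<and> (malcev_algebra scale mul \<and> vector_space.dim scale (UNIV :: 'a set) = 6 \<and>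
          nonassoc_algebra.nilpotent scale mul \<longrightarrow>
            cd_algebra scale mul)"
proof (intro conjI impI; elim conjE)
  assume A: "anticommutative_algebra scale mul" "vector_space.dim scale (UNIV :: 'a set) = 6"
    "nonassoc_algebra.nilpotent scale mul" and cd: "cd_algebra scale mul"
  obtain Basis where "six_dim_nilpotent_algebra scale mul Basis"
    using six_dim_nilpotent_algebraI[OF assms A] .
  then interpret six_dim_nilpotent_algebra scale mul Basis .
  show "(\<exists>m :: 'f ^ 6 \<Rightarrow> 'f ^ 6 \<Rightarrow> 'f ^ 6. malcev_algebra (*s) m \<and> algebra_isomorphic scale mul (*s) m) \<or>
      (\<exists>\<alpha>. algebra_isomorphic scale mul (*s) (B61 \<alpha>))"
    using cd_imp_malcev_or_B61 malcev_isomorphic cd cd_algebra_iff by blast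
next
  assume malcev: "malcev_algebra scale mul" and A: "vector_space.dim scale (UNIV :: 'a set) = 6"
    "nonassoc_algebra.nilpotent scale mul"
  then have "anticommutative_algebra scale mul"
    by (simp add: malcev_algebra_def)
  then obtain Basis where "six_dim_nilpotent_algebra scale mul Basis"
    using six_dim_nilpotent_algebraI[OF assms _ A] by blast
  then interpret six_dim_nilpotent_algebra scale mul Basis .
  show "cd_algebra scale mul"
    using malcev malcev_algebra_iff malcev_imp_cd cd_algebra_iff by blast
qed

end
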